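(* There exist convex bodies $M_n\in\mathcal{K}_n$ such that, as $n\to\infty$, $$d(j(M_n),l(M_n))=1-\frac{8}{n}+o\left(\frac1n\right).$$
   Context: A convex body is a compact convex subset of $\mathbb{R}^n$ with non-empty interior; $\mathcal{K}_n$ is the set of all convex bodies in $\mathbb{R}^n$. For $K\in\mathcal{K}_n$, $j(K)$ is the center of the John ellipsoid of $K$ (the unique ellipsoid of maximal volume contained in $K$) and $l(K)$ is the center of the L\"owner ellipsoid of $K$ (the unique ellipsoid of minimal volume containing $K$). For two points $p_1(K),p_2(K)\in K$, set $d(p_1(K),p_2(K))=0$ if $p_1(K)=p_2(K)$, and otherwise $$d(p_1(K),p_2(K))=\frac{\|p_1(K)-p_2(K)\|}{\mathrm{vol}_1(\ell\cap K)},$$ where $\ell$ is the line through $p_1(K)$ and $p_2(K)$, $\|\cdot\|$ is the Euclidean norm and $\mathrm{vol}_1$ is length. *)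

theory Defs
  imports "HOL-Analysis.Analysis" "HOL-Library.Landau_Symbols"
begin

text \<open>
  The dimension \<open>n\<close> varies inside the statement, so $n$-dimensional space is the library's
  \<^const>\<open>Euclidean_space\<close> \<open>n\<close>: the functions \<open>nat \<Rightarrow> real\<close> vanishing at all indices \<open>\<ge> n\<close>, with the
  product topology. The vector operations on it are written out pointwise.
\<close>

type_synonym point = "nat \<Rightarrow> real"

definition enorm :: "nat \<Rightarrow> point \<Rightarrow> real" where
  "enorm n x = L2_set x {..<n}"

text \<open>
  Lebesgue measure is the library's product measure, whose underlying space consists of functions
  that are \<^const>\<open>undefined\<close> (rather than 0) outside \<open>{..<n}\<close>; hence the restriction.
\<close>

definition vol :: "nat \<Rightarrow> point set \<Rightarrow> real" where
  "vol n S = measure (Pi\<^sub>M {..<n} (\<lambda>_. lborel)) ((\<lambda>x. restrict x {..<n}) ` S)"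

definition convex_pts :: "point set \<Rightarrow> bool" where
  "convex_pts S \<longleftrightarrow>
     (\<forall>x\<in>S. \<forall>y\<in>S. \<forall>t\<in>{0..1}. (\<lambda>i. (1 - t) * x i + t * y i) \<in> S)"

definition convex_bodies :: "nat \<Rightarrow> point set set" where
  "convex_bodies n =
     {K. compactin (Euclidean_space n) K \<and> convex_pts K \<and> Euclidean_space n interior_of K \<noteq> {}}"

definition unit_ball :: "nat \<Rightarrow> point set" where
  "unit_ball n = {u \<in> topspace (Euclidean_space n). enorm n u \<le> 1}"

definition mat_apply :: "nat \<Rightarrow> (nat \<Rightarrow> nat \<Rightarrow> real) \<Rightarrow> point \<Rightarrow> point" where
  "mat_apply n A x = (\<lambda>i. if i < n then \<Sum>j<n. A i j * x j else 0)"

text \<open>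
  An ellipsoid with center \<open>c\<close> is the image of the unit ball under a nonsingular affine map taking
  the origin to \<open>c\<close>.
\<close>

definition ellipsoid_at :: "nat \<Rightarrow> point \<Rightarrow> point set \<Rightarrow> bool" where
  "ellipsoid_at n c E \<longleftrightarrow> c \<in> topspace (Euclidean_space n) \<and>
     (\<exists>A. bij_betw (mat_apply n A) (topspace (Euclidean_space n)) (topspace (Euclidean_space n)) \<and>
          E = (\<lambda>u i. c i + mat_apply n A u i) ` unit_ball n)"

definition ellipsoid :: "nat \<Rightarrow> point set \<Rightarrow> bool" where
  "ellipsoid n E \<longleftrightarrow> (\<exists>c. ellipsoid_at n c E)"

definition ellipsoid_center :: "nat \<Rightarrow> point set \<Rightarrow> point" where
  "ellipsoid_center n E = (THE c. ellipsoid_at n c E)"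

definition john_ellipsoid :: "nat \<Rightarrow> point set \<Rightarrow> point set" where
  "john_ellipsoid n K =
     (THE E. ellipsoid n E \<and> E \<subseteq> K \<and> (\<forall>E'. ellipsoid n E' \<and> E' \<subseteq> K \<longrightarrow> vol n E' \<le> vol n E))"

definition loewner_ellipsoid :: "nat \<Rightarrow> point set \<Rightarrow> point set" where
  "loewner_ellipsoid n K =
     (THE E. ellipsoid n E \<and> K \<subseteq> E \<and> (\<forall>E'. ellipsoid n E' \<and> K \<subseteq> E' \<longrightarrow> vol n E \<le> vol n E'))"

definition john_center :: "nat \<Rightarrow> point set \<Rightarrow> point" where
  "john_center n K = ellipsoid_center n (john_ellipsoid n K)"

definition loewner_center :: "nat \<Rightarrow> point set \<Rightarrow> point" where
  "loewner_center n K = ellipsoid_center n (loewner_ellipsoid n K)"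

definition line_through :: "point \<Rightarrow> point \<Rightarrow> point set" where
  "line_through p q = range (\<lambda>t i. p i + t * (q i - p i))"

text \<open>
  Length of a subset \<open>S\<close> of the line through \<open>p \<noteq> q\<close>: the one-dimensional Lebesgue measure of its
  preimage under the unit-speed parametrization of that line.
\<close>

definition vol1_on_line :: "nat \<Rightarrow> point \<Rightarrow> point \<Rightarrow> point set \<Rightarrow> real" where
  "vol1_on_line n p q S =
     measure lborel {t. (\<lambda>i. p i + t * ((q i - p i) / enorm n (\<lambda>k. q k - p k))) \<in> S}"

definition rel_dist :: "nat \<Rightarrow> point set \<Rightarrow> point \<Rightarrow> point \<Rightarrow> real" where
  "rel_dist n K p q =
     (if p = q then 0
      else enorm n (\<lambda>i. p i - q i) / vol1_on_line n p q (line_through p q \<inter> K))"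

end

theory Submission
  imports Defs "HOL-Real_Asymp.Real_Asymp"
begin

text \<open>
  Let \<open>K\<close> be the set of points of the unit ball with \<open>-2/n \<le> x\<^sub>0 \<le> 1/2\<close> and \<open>\<bar>x\<^sub>i\<bar> \<le> f(x\<^sub>0)\<close> for
  \<open>i \<ge> 1\<close>, where \<open>f\<close> is affine with \<open>f(-2/n) = 3/8\<close> and \<open>f(1/2) = 1/2\<close>. The unit ball is the
  Loewner ellipsoid of \<open>K\<close>: the points of the unit sphere with \<open>x\<^sub>0 = -2/n\<close> or \<open>x\<^sub>0 = 1/2\<close> whose other
  coordinates all have the same absolute value lie in \<open>K\<close>, and suitably weighted they form a
  decomposition of the identity as in John's theorem. The John ellipsoid of \<open>K\<close> touches \<open>x\<^sub>0 = 1/2\<close>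
  and the lateral facets, so it is the John ellipsoid of a cone over a cube. Its center is at
  relative distance about \<open>4/n\<close> from the top end of the axis, while the origin is at relative
  distance about \<open>4/n\<close> from the bottom end.

  Every ellipsoid can be written \<open>{x. \<parallel>T (x - c)\<parallel> \<le> 1}\<close> with \<open>T\<close> lower triangular, and then its
  volume is that of the unit ball divided by the product of the diagonal entries of \<open>T\<close>. Both
  extremality claims thus reduce to a bound on a sum over the diagonal and the inequality of
  arithmetic and geometric means; no determinants are needed.
\<close>

subsection \<open>Triangular normal form of ellipsoids\<close>

text \<open>A positive diagonal is part of the notion, so such a matrix is invertible and its
  diagonal product can be divided by.\<close>

definition lower_triangular :: "nat \<Rightarrow> (nat \<Rightarrow> nat \<Rightarrow> real) \<Rightarrow> bool" where
  "lower_triangular n T \<longleftrightarrow> (\<forall>i<n. 0 < T i i \<and> (\<forall>j>i. T i j = 0))"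

text \<open>\<open>T\<close> maps the ellipsoid to the unit ball, opposite to the matrix in
  \<open>ellipsoid_at\<close>. Membership of a point is thus a direct bound on
  \<open>T (x - c)\<close>.\<close>

definition triangular_ellipsoid :: "nat \<Rightarrow> (nat \<Rightarrow> nat \<Rightarrow> real) \<Rightarrow> point \<Rightarrow> point set" where
  "triangular_ellipsoid n T c =
     {x \<in> topspace (Euclidean_space n). enorm n (mat_apply n T (\<lambda>i. x i - c i)) \<le> 1}"

lemma enorm_le_1_iff: "enorm n x \<le> 1 \<longleftrightarrow> (\<Sum>i<n. (x i)\<^sup>2) \<le> 1"
  by (simp add: enorm_def L2_set_def)

text \<open>Completing the square in the last variable; the remaining form is the Schur complement
  of \<open>G n n\<close>.\<close>

lemma quadratic_form_Suc:
  fixes G :: "nat \<Rightarrow> nat \<Rightarrow> real"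
  assumes sym: "\<And>i j. i < Suc n \<Longrightarrow> j < Suc n \<Longrightarrow> G i j = G j i" and g: "0 < G n n"
  shows "(\<Sum>i<Suc n. \<Sum>j<Suc n. G i j * x i * x j) =
     (\<Sum>i<n. \<Sum>j<n. (G i j - G i n * G n j / G n n) * x i * x j)
       + G n n * (x n + (\<Sum>j<n. G n j * x j) / G n n)\<^sup>2"
proof -
  define s where "s = (\<Sum>j<n. G n j * x j)"
  have s': "(\<Sum>i<n. G i n * x i) = s"
    unfolding s_def by (intro sum.cong) (auto simp: sym)
  have "(\<Sum>i<Suc n. \<Sum>j<Suc n. G i j * x i * x j) =
      (\<Sum>i<n. \<Sum>j<n. G i j * x i * x j) + (\<Sum>i<n. G i n * x i * x n) + (\<Sum>j<n. G n j * x n * x j)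
      + G n n * x n * x n"
    by (simp add: sum.distrib)
  also have "(\<Sum>i<n. G i n * x i * x n) = s * x n"
    by (simp add: s'[symmetric] sum_distrib_right)
  also have "(\<Sum>j<n. G n j * x n * x j) = s * x n"
    unfolding s_def sum_distrib_right by (intro sum.cong) (auto simp: algebra_simps)
  finally have 1: "(\<Sum>i<Suc n. \<Sum>j<Suc n. G i j * x i * x j) =
      (\<Sum>i<n. \<Sum>j<n. G i j * x i * x j) + 2 * s * x n + G n n * (x n)\<^sup>2"
    by (simp add: power2_eq_square)
  have "(\<Sum>i<n. \<Sum>j<n. G i n * G n j / G n n * x i * x j) =
      (\<Sum>i<n. \<Sum>j<n. (G i n * x i) * (G n j * x j)) / G n n"
    by (simp add: sum_divide_distrib algebra_simps)
  also have "\<dots> = s * s / G n n"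
    unfolding sum_product[symmetric] s' s_def[symmetric] ..
  finally have 2: "(\<Sum>i<n. \<Sum>j<n. (G i j - G i n * G n j / G n n) * x i * x j) =
      (\<Sum>i<n. \<Sum>j<n. G i j * x i * x j) - s * s / G n n"
    by (simp add: left_diff_distrib sum_subtractf)
  show ?thesis
    unfolding 1 2 s_def[symmetric] using g by (simp add: field_simps power2_eq_square)
qed

text \<open>Induction on the dimension: the completed square supplies the last row of
  \<open>T\<close>, and the Schur complement is again positive definite.\<close>

lemma cholesky_decomposition:
  fixes G :: "nat \<Rightarrow> nat \<Rightarrow> real"
  assumes "\<And>i j. i < n \<Longrightarrow> j < n \<Longrightarrow> G i j = G j i"
    and "\<And>x. \<exists>i<n. x i \<noteq> 0 \<Longrightarrow> 0 < (\<Sum>i<n. \<Sum>j<n. G i j * x i * x j)"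
  shows "\<exists>T. lower_triangular n T \<and>
    (\<forall>x. (\<Sum>i<n. \<Sum>j<n. G i j * x i * x j) = (\<Sum>i<n. (\<Sum>j<n. T i j * x j)\<^sup>2))"
  using assms
proof (induction n arbitrary: G)
  case 0
  then show ?case by (simp add: lower_triangular_def)
next
  case (Suc n)
  have g: "0 < G n n"
    using Suc.prems(2)[of "\<lambda>i. if i = n then 1 else 0"]
    by (simp add: if_distrib[where f="\<lambda>x. _ * x"] cong: if_cong)
  have quad: "(\<Sum>i<Suc n. \<Sum>j<Suc n. G i j * x i * x j) =
     (\<Sum>i<n. \<Sum>j<n. (G i j - G i n * G n j / G n n) * x i * x j)
       + G n n * (x n + (\<Sum>j<n. G n j * x j) / G n n)\<^sup>2" for x
    by (rule quadratic_form_Suc[where G=G, OF _ g]) (rule Suc.prems(1))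
  have "\<exists>T. lower_triangular n T \<and>
    (\<forall>x. (\<Sum>i<n. \<Sum>j<n. (G i j - G i n * G n j / G n n) * x i * x j) = (\<Sum>i<n. (\<Sum>j<n. T i j * x j)\<^sup>2))"
  proof (rule Suc.IH)
    fix i j assume "i < n" "j < n"
    then show "G i j - G i n * G n j / G n n = G j i - G j n * G n i / G n n"
      using Suc.prems(1) by (simp add: mult.commute)
  next
    fix x :: point assume x: "\<exists>i<n. x i \<noteq> 0"
    \<comment> \<open>This last coordinate makes the completed square vanish, so the full form at
      \<open>y\<close> is the Schur complement form at \<open>x\<close>.\<close>
    define y where "y = x(n := - (\<Sum>j<n. G n j * x j) / G n n)"
    have "0 < (\<Sum>i<Suc n. \<Sum>j<Suc n. G i j * y i * y j)"
      using x by (intro Suc.prems(2)) (auto simp: y_def)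
    also have "\<dots> = (\<Sum>i<n. \<Sum>j<n. (G i j - G i n * G n j / G n n) * x i * x j)"
      unfolding quad using g by (simp add: y_def del: sum.lessThan_Suc)
    finally show "0 < (\<Sum>i<n. \<Sum>j<n. (G i j - G i n * G n j / G n n) * x i * x j)" .
  qed
  then obtain T' where T': "lower_triangular n T'"
    "\<And>x. (\<Sum>i<n. \<Sum>j<n. (G i j - G i n * G n j / G n n) * x i * x j) = (\<Sum>i<n. (\<Sum>j<n. T' i j * x j)\<^sup>2)"
    by blast
  \<comment> \<open>The last row is the completed square with the factor \<open>sqrt (G n n)\<close>
    absorbed.\<close>
  define T where "T i j = (if i < n then T' i j else if j \<le> n then G n j / sqrt (G n n) else 0)" for i j
  have "lower_triangular (Suc n) T"
    using T'(1) g by (auto simp: lower_triangular_def T_def less_Suc_eq)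
  moreover have "(\<Sum>i<Suc n. \<Sum>j<Suc n. G i j * x i * x j) = (\<Sum>i<Suc n. (\<Sum>j<Suc n. T i j * x j)\<^sup>2)" for x
  proof -
    have "(\<Sum>j<Suc n. T i j * x j) = (\<Sum>j<n. T' i j * x j)" if "i < n" for i
      using that T'(1) by (simp add: T_def lower_triangular_def)
    then have "(\<Sum>i<n. (\<Sum>j<Suc n. T i j * x j)\<^sup>2) = (\<Sum>i<n. (\<Sum>j<n. T' i j * x j)\<^sup>2)"
      by (intro sum.cong) auto
    moreover have "(\<Sum>j<Suc n. T n j * x j) = sqrt (G n n) * (x n + (\<Sum>j<n. G n j * x j) / G n n)"
    proof -
      have "(\<Sum>j<Suc n. T n j * x j) = (\<Sum>j<Suc n. G n j * x j) / sqrt (G n n)"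
        unfolding sum_divide_distrib by (intro sum.cong) (auto simp: T_def)
      also have "\<dots> = sqrt (G n n) * ((\<Sum>j<Suc n. G n j * x j) / G n n)"
        using g by (simp add: field_simps)
      finally show ?thesis
        using g by (simp add: add_divide_distrib)
    qed
    ultimately show ?thesis
      unfolding quad T'(2) sum.lessThan_Suc[of "\<lambda>i. (\<Sum>j<Suc n. T i j * x j)\<^sup>2"]
      using g by (simp add: power_mult_distrib del: sum.lessThan_Suc)
  qed
  ultimately show ?case by blast
qed

text \<open>Forward substitution. It turns the description of an ellipsoid by \<open>T\<close> into
  a parametrization by the unit ball, with reciprocal diagonal.\<close>

lemma lower_triangular_right_inverse:
  assumes "lower_triangular n T"
  shows "\<exists>S. lower_triangular n S \<and> (\<forall>i<n. S i i = inverse (T i i)) \<and>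
    (\<forall>x. \<forall>i<n. (\<Sum>j<n. T i j * mat_apply n S x j) = x i)"
  using assms
proof (induction n)
  case 0
  then show ?case by (simp add: lower_triangular_def)
next
  case (Suc n)
  then have t: "0 < T n n" and "lower_triangular n T"
    by (auto simp: lower_triangular_def)
  then obtain S' where S': "lower_triangular n S'" "\<And>i. i < n \<Longrightarrow> S' i i = inverse (T i i)"
    "\<And>x i. i < n \<Longrightarrow> (\<Sum>j<n. T i j * mat_apply n S' x j) = x i"
    using Suc.IH by blast
  define S where "S i j = (if i < n then S' i j else if j < n then - (\<Sum>k<n. T n k * S' k j) / T n n
      else if j = n then inverse (T n n) else 0)" for i j
  have "lower_triangular (Suc n) S"
    using S'(1) t by (auto simp: lower_triangular_def S_def less_Suc_eq)
  moreover have "\<forall>i<Suc n. S i i = inverse (T i i)"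
    using S'(2) by (auto simp: S_def less_Suc_eq)
  moreover have "(\<Sum>j<Suc n. T i j * mat_apply (Suc n) S x j) = x i" if "i < Suc n" for i x
  proof -
    have lo: "mat_apply (Suc n) S x j = mat_apply n S' x j" if "j < n" for j
      using that S'(1) by (simp add: mat_apply_def S_def lower_triangular_def)
    then have sum: "(\<Sum>j<n. T i j * mat_apply (Suc n) S x j) = (\<Sum>j<n. T i j * mat_apply n S' x j)"
      by (intro sum.cong) auto
    show ?thesis
    proof (cases "i = n")
      case True
      have "T n n * (\<Sum>j<n. S n j * x j) = - (\<Sum>j<n. (\<Sum>k<n. T n k * S' k j) * x j)"
        using t by (simp add: S_def sum_distrib_left sum_negf)
      also have "(\<Sum>j<n. (\<Sum>k<n. T n k * S' k j) * x j) = (\<Sum>k<n. \<Sum>j<n. T n k * S' k j * x j)"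
        unfolding sum_distrib_right by (rule sum.swap)
      also have "\<dots> = (\<Sum>k<n. T n k * mat_apply n S' x k)"
        by (simp add: mat_apply_def sum_distrib_left mult.assoc)
      finally have "T n n * mat_apply (Suc n) S x n = x n - (\<Sum>k<n. T n k * mat_apply n S' x k)"
        using t by (simp add: mat_apply_def distrib_left) (simp add: S_def)
      then show ?thesis
        unfolding sum.lessThan_Suc sum by (simp add: True)
    next
      case False
      then have "i < n" using that by simp
      moreover from this have "T i n = 0"
        using Suc.prems by (simp add: lower_triangular_def)
      ultimately show ?thesis
        unfolding sum.lessThan_Suc sum by (simp add: S'(3))
    qed
  qed
  ultimately show ?case by blast
qed

lemma mat_apply_in_space [simp]: "mat_apply n A x \<in> topspace (Euclidean_space n)"
  by (simp add: mat_apply_def topspace_Euclidean_space)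

lemma mat_apply_cong: "(\<And>j. j < n \<Longrightarrow> x j = y j) \<Longrightarrow> mat_apply n A x = mat_apply n A y"
  by (auto simp: mat_apply_def intro!: sum.cong)

lemma sum_quadratic_form:
  "(\<Sum>i<n. (\<Sum>j<n. B i j * x j)\<^sup>2) = (\<Sum>j<n. \<Sum>k<n. (\<Sum>i<n. B i j * B i k) * x j * (x k :: real))"
proof -
  have "(\<Sum>i<n. (\<Sum>j<n. B i j * x j)\<^sup>2) = (\<Sum>i<n. \<Sum>j<n. \<Sum>k<n. B i j * B i k * x j * x k)"
    unfolding power2_eq_square sum_product by (intro sum.cong) (auto simp: algebra_simps)
  also have "\<dots> = (\<Sum>j<n. \<Sum>i<n. \<Sum>k<n. B i j * B i k * x j * x k)"
    by (rule sum.swap)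
  also have "\<dots> = (\<Sum>j<n. \<Sum>k<n. \<Sum>i<n. B i j * B i k * x j * x k)"
    by (rule sum.cong[OF refl], rule sum.swap)
  finally show ?thesis
    by (simp add: sum_distrib_right)
qed

text \<open>The columns of \<open>B\<close> are the preimages of the unit vectors; linearity makes
  \<open>B\<close> a right inverse, and injectivity of \<open>A\<close> makes it a left
  inverse.\<close>

lemma inverse_matrix_exists:
  assumes "bij_betw (mat_apply n A) (topspace (Euclidean_space n)) (topspace (Euclidean_space n))"
  obtains B where "\<And>x. x \<in> topspace (Euclidean_space n) \<Longrightarrow> mat_apply n A (mat_apply n B x) = x"
    "\<And>x. x \<in> topspace (Euclidean_space n) \<Longrightarrow> mat_apply n B (mat_apply n A x) = x"
proof -
  let ?V = "topspace (Euclidean_space n)"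
  define g where "g = inv_into ?V (mat_apply n A)"
  define B where "B i j = g (\<lambda>k. if k = j then 1 else 0) i" for i j
  have Ag: "mat_apply n A (g y) = y" if "y \<in> ?V" for y
    using that assms by (simp add: g_def bij_betw_def f_inv_into_f)
  have 1: "mat_apply n A (mat_apply n B x) = x" if x: "x \<in> ?V" for x
  proof
    fix i
    show "mat_apply n A (mat_apply n B x) i = x i"
    proof (cases "i < n")
      case True
      have "mat_apply n A (mat_apply n B x) i = (\<Sum>k<n. \<Sum>j<n. A i k * B k j * x j)"
        using True by (simp add: mat_apply_def sum_distrib_left mult.assoc)
      also have "\<dots> = (\<Sum>j<n. \<Sum>k<n. A i k * B k j * x j)"
        by (rule sum.swap)
      also have "\<dots> = (\<Sum>j<n. x j * mat_apply n A (g (\<lambda>k. if k = j then 1 else 0)) i)"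
        using True by (simp add: mat_apply_def B_def sum_distrib_left algebra_simps)
      also have "\<dots> = (\<Sum>j<n. x j * (if i = j then 1 else 0))"
        by (intro sum.cong refl, subst Ag) (auto simp: topspace_Euclidean_space)
      also have "\<dots> = x i"
        using True by (simp add: if_distrib[where f="(*) _"] cong: if_cong)
      finally show ?thesis .
    qed (use x in \<open>auto simp: mat_apply_def topspace_Euclidean_space\<close>)
  qed
  have 2: "mat_apply n B (mat_apply n A x) = x" if "x \<in> ?V" for x
    by (rule inj_onD[OF bij_betw_imp_inj_on[OF assms]]) (use that 1[of "mat_apply n A x"] in auto)
  show thesis
    using that 1 2 by blast
qed

text \<open>With \<open>B\<close> inverse to \<open>A\<close>, the ellipsoid is the set where
  \<open>B (x - c)\<close> has norm at most 1. The Cholesky factor \<open>T\<close> of the Gram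
  matrix of \<open>B\<close> gives the same norm.\<close>

lemma ellipsoid_at_imp_triangular:
  assumes "ellipsoid_at n c E"
  obtains T where "lower_triangular n T" "E = triangular_ellipsoid n T c"
proof -
  let ?V = "topspace (Euclidean_space n)"
  from assms obtain A where c: "c \<in> ?V" and A: "bij_betw (mat_apply n A) ?V ?V"
    and E: "E = (\<lambda>u i. c i + mat_apply n A u i) ` unit_ball n"
    by (auto simp: ellipsoid_at_def)
  obtain B where B: "\<And>x. x \<in> ?V \<Longrightarrow> mat_apply n A (mat_apply n B x) = x"
    "\<And>x. x \<in> ?V \<Longrightarrow> mat_apply n B (mat_apply n A x) = x"
    using inverse_matrix_exists[OF A] by blast
  define G where "G j k = (\<Sum>i<n. B i j * B i k)" for j k
  have G: "(\<Sum>i<n. \<Sum>j<n. G i j * x i * x j) = (\<Sum>i<n. (mat_apply n B x i)\<^sup>2)" for x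
    using sum_quadratic_form[where B=B and x=x and n=n] by (simp add: G_def mat_apply_def)
  have "\<exists>T. lower_triangular n T \<and>
    (\<forall>x. (\<Sum>i<n. \<Sum>j<n. G i j * x i * x j) = (\<Sum>i<n. (\<Sum>j<n. T i j * x j)\<^sup>2))"
  proof (rule cholesky_decomposition)
    fix x :: point assume "\<exists>i<n. x i \<noteq> 0"
    then obtain i where i: "i < n" "x i \<noteq> 0" by blast
    \<comment> \<open>\<open>x\<close> is arbitrary beyond index \<open>n\<close>; its truncation
      lies in the space, where \<open>B\<close> inverts \<open>A\<close>.\<close>
    define y where "y = (\<lambda>i. if i < n then x i else 0)"
    have "y \<in> ?V" by (simp add: y_def topspace_Euclidean_space)
    have xy: "mat_apply n B x = mat_apply n B y"
      by (auto simp: mat_apply_def y_def intro!: sum.cong)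
    have "mat_apply n B y \<noteq> (\<lambda>_. 0)"
    proof
      assume "mat_apply n B y = (\<lambda>_. 0)"
      then have "y i = mat_apply n A (\<lambda>_. 0) i" using B(1)[OF \<open>y \<in> ?V\<close>] by simp
      then show False using i by (simp add: y_def mat_apply_def)
    qed
    then obtain k where "k < n" "mat_apply n B y k \<noteq> 0"
      by (force simp: mat_apply_def fun_eq_iff split: if_splits)
    then show "0 < (\<Sum>i<n. \<Sum>j<n. G i j * x i * x j)"
      unfolding G xy by (intro sum_pos2[of _ k]) auto
  qed (simp add: G_def mult.commute)
  then obtain T where T: "lower_triangular n T"
    "\<And>x. (\<Sum>i<n. \<Sum>j<n. G i j * x i * x j) = (\<Sum>i<n. (\<Sum>j<n. T i j * x j)\<^sup>2)"
    by blast
  have "(\<Sum>i<n. (mat_apply n B x i)\<^sup>2) = (\<Sum>i<n. (mat_apply n T x i)\<^sup>2)" for x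
    using G T(2) by (simp add: mat_apply_def)
  then have norm: "enorm n (mat_apply n B x) \<le> 1 \<longleftrightarrow> enorm n (mat_apply n T x) \<le> 1" for x
    by (simp add: enorm_le_1_iff)
  have "x \<in> E \<longleftrightarrow> x \<in> triangular_ellipsoid n T c" for x
  proof
    assume "x \<in> E"
    then obtain u where u: "u \<in> unit_ball n" "x = (\<lambda>i. c i + mat_apply n A u i)"
      using E by blast
    then have "mat_apply n B (\<lambda>i. x i - c i) = u"
      using B(2) by (simp add: unit_ball_def)
    then have "enorm n (mat_apply n T (\<lambda>i. x i - c i)) \<le> 1"
      using u by (simp add: norm[symmetric] unit_ball_def)
    moreover have "x \<in> ?V"
      using c mat_apply_in_space[of n A u] by (simp add: topspace_Euclidean_space u(2))
    ultimately show "x \<in> triangular_ellipsoid n T c"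
      by (simp add: triangular_ellipsoid_def)
  next
    assume x: "x \<in> triangular_ellipsoid n T c"
    then have "(\<lambda>i. x i - c i) \<in> ?V"
      using c by (simp add: triangular_ellipsoid_def topspace_Euclidean_space)
    then have "x = (\<lambda>i. c i + mat_apply n A (mat_apply n B (\<lambda>i. x i - c i)) i)"
      using B(1) by simp
    moreover have "mat_apply n B (\<lambda>i. x i - c i) \<in> unit_ball n"
      using x by (simp add: unit_ball_def norm triangular_ellipsoid_def)
    ultimately show "x \<in> E"
      unfolding E by blast
  qed
  then have "E = triangular_ellipsoid n T c" by blast
  with T(1) show thesis by (rule that)
qed

subsection \<open>Volume of a triangular ellipsoid\<close>

text \<open>Change of variables for an affine triangular map. Integrating over the last coordinate
  first leaves a one-dimensional affine substitution with factor \<open>T n n\<close>; the remaining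
  coordinates are covered by induction.\<close>

lemma nn_integral_triangular:
  fixes f :: "point \<Rightarrow> ennreal"
  assumes "lower_triangular n T" "f \<in> borel_measurable (Pi\<^sub>M {..<n} (\<lambda>_. lborel))"
  shows "ennreal (\<Prod>i<n. T i i) *
      (\<integral>\<^sup>+x. f (\<lambda>i\<in>{..<n}. (\<Sum>j<n. T i j * x j) + d i) \<partial>Pi\<^sub>M {..<n} (\<lambda>_. lborel))
    = (\<integral>\<^sup>+x. f x \<partial>Pi\<^sub>M {..<n} (\<lambda>_. lborel))"
  using assms
proof (induction n arbitrary: f)
  case 0
  show ?case
    by (simp add: PiM_empty nn_integral_count_space_finite)
next
  case (Suc n)
  interpret product_sigma_finite "\<lambda>_::nat. lborel :: real measure"
    by standard
  let ?M = "\<lambda>n. Pi\<^sub>M {..<n} (\<lambda>_. lborel :: real measure)"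
  have T: "lower_triangular n T" and t: "0 < T n n" and Tn: "\<And>i. i < n \<Longrightarrow> T i n = 0"
    using Suc.prems(1) by (auto simp: lower_triangular_def)
  note Suc.prems(2)[unfolded lessThan_Suc, measurable]
  define F where "F x = (\<lambda>i\<in>{..<n}. (\<Sum>j<n. T i j * x j) + d i)" for x
  define g where "g x = (\<integral>\<^sup>+y. f (x(n := y)) \<partial>lborel)" for x
  have [measurable]: "g \<in> borel_measurable (?M n)"
    unfolding g_def by measurable
  have [measurable]: "F \<in> ?M n \<rightarrow>\<^sub>M ?M n"
    unfolding F_def by measurable
  \<comment> \<open>Column \<open>n\<close> is zero above the diagonal, so \<open>y\<close> enters
    only the last coordinate of the image.\<close>
  have eq: "(\<lambda>i\<in>{..<Suc n}. (\<Sum>j<Suc n. T i j * (x(n := y)) j) + d i)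
      = (F x)(n := (\<Sum>j<n. T n j * x j) + d n + T n n * y)" for x y
    by (auto simp: F_def fun_eq_iff Tn less_Suc_eq)
  have [measurable]: "(\<lambda>x. f (\<lambda>i\<in>insert n {..<n}. (\<Sum>j<Suc n. T i j * x j) + d i))
      \<in> borel_measurable (Pi\<^sub>M (insert n {..<n}) (\<lambda>_. lborel))"
  proof -
    have "(\<lambda>x. \<lambda>i\<in>insert n {..<n}. (\<Sum>j<Suc n. T i j * x j) + d i)
        \<in> Pi\<^sub>M (insert n {..<n}) (\<lambda>_. lborel) \<rightarrow>\<^sub>M Pi\<^sub>M (insert n {..<n}) (\<lambda>_. lborel)"
      by (rule measurable_restrict) (auto simp: lessThan_Suc[symmetric] simp del: sum.lessThan_Suc)
    from measurable_compose[OF this] show ?thesis by simp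
  qed
  \<comment> \<open>Translation invariance absorbs \<open>a\<close>, which stands for the
    contribution of the other coordinates and of the shift.\<close>
  have inner: "ennreal (T n n) * (\<integral>\<^sup>+y. f ((F x)(n := a + T n n * y)) \<partial>lborel) = g (F x)"
    if "x \<in> space (?M n)" for x a
  proof -
    have [measurable]: "F x \<in> space (?M n)" by (simp add: F_def space_PiM)
    have "(\<lambda>y. (F x)(n := y)) \<in> lborel \<rightarrow>\<^sub>M Pi\<^sub>M (insert n {..<n}) (\<lambda>_. lborel)"
      by measurable
    then have "(\<lambda>y. f ((F x)(n := y))) \<in> borel_measurable borel"
      using measurable_compose[of _ lborel _ f borel] Suc.prems(2) by (simp add: lessThan_Suc)
    from nn_integral_real_affine[OF this, of "T n n" a] show ?thesis
      using t by (simp add: g_def)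
  qed
  have "(\<integral>\<^sup>+x. f (\<lambda>i\<in>{..<Suc n}. (\<Sum>j<Suc n. T i j * x j) + d i) \<partial>?M (Suc n))
      = (\<integral>\<^sup>+x. (\<integral>\<^sup>+y. f (\<lambda>i\<in>{..<Suc n}. (\<Sum>j<Suc n. T i j * (x(n := y)) j) + d i) \<partial>lborel) \<partial>?M n)"
    unfolding lessThan_Suc[of n] by (subst product_nn_integral_insert) auto
  also have "\<dots> = (\<integral>\<^sup>+x. (\<integral>\<^sup>+y. f ((F x)(n := (\<Sum>j<n. T n j * x j) + d n + T n n * y)) \<partial>lborel) \<partial>?M n)"
    unfolding eq ..
  finally have 1: "(\<integral>\<^sup>+x. f (\<lambda>i\<in>{..<Suc n}. (\<Sum>j<Suc n. T i j * x j) + d i) \<partial>?M (Suc n)) = \<dots>" .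
  have [measurable]: "(\<lambda>x. \<integral>\<^sup>+y. f ((F x)(n := (\<Sum>j<n. T n j * x j) + d n + T n n * y)) \<partial>lborel)
      \<in> borel_measurable (?M n)"
    by measurable
  have "ennreal (T n n) * (\<integral>\<^sup>+x. f (\<lambda>i\<in>{..<Suc n}. (\<Sum>j<Suc n. T i j * x j) + d i) \<partial>?M (Suc n))
      = (\<integral>\<^sup>+x. g (F x) \<partial>?M n)"
    unfolding 1 by (subst nn_integral_cmult[symmetric]) (auto intro!: nn_integral_cong inner)
  also have "ennreal (\<Prod>i<n. T i i) * \<dots> = (\<integral>\<^sup>+x. g x \<partial>?M n)"
    unfolding F_def by (rule Suc.IH[OF T]) measurable
  also have "\<dots> = (\<integral>\<^sup>+x. f x \<partial>?M (Suc n))"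
    unfolding lessThan_Suc[of n] g_def by (subst product_nn_integral_insert) auto
  moreover have "ennreal (\<Prod>i<Suc n. T i i) = ennreal (\<Prod>i<n. T i i) * ennreal (T n n)"
    unfolding prod.lessThan_Suc using t T
    by (intro ennreal_mult prod_nonneg) (auto simp: lower_triangular_def less_imp_le)
  ultimately show ?case
    by (simp only: mult.assoc)
qed

text \<open>The ellipsoid is the preimage of the unit ball under an affine triangular map, so the
  change of variables applies to the indicator of the ball.\<close>

lemma vol_triangular_ellipsoid:
  assumes T: "lower_triangular n T" and c: "c \<in> topspace (Euclidean_space n)"
  shows "vol n (triangular_ellipsoid n T c) = unit_ball_vol n / (\<Prod>i<n. T i i)"
proof -
  let ?M = "Pi\<^sub>M {..<n} (\<lambda>_. lborel :: real measure)"
  define B where "B = {f. sqrt (\<Sum>i<n. (f i)\<^sup>2) \<le> 1} \<inter> space ?M"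
  define F where "F x = (\<lambda>i\<in>{..<n}. (\<Sum>j<n. T i j * x j) + (- (\<Sum>j<n. T i j * c j)))" for x
  have [measurable]: "B \<in> sets ?M"
    unfolding B_def by measurable
  have [measurable]: "F \<in> ?M \<rightarrow>\<^sub>M ?M"
    unfolding F_def by measurable
  have p: "(\<Prod>i<n. T i i) > 0"
    using T by (auto simp: lower_triangular_def intro: prod_pos)
  have F: "F x i = mat_apply n T (\<lambda>i. x i - c i) i" if "i < n" for x i
    using that by (simp add: F_def mat_apply_def right_diff_distrib sum_subtractf)
  have FB: "x \<in> F -` B \<inter> space ?M \<longleftrightarrow> x \<in> space ?M \<and> enorm n (mat_apply n T (\<lambda>i. x i - c i)) \<le> 1" for x
  proof -
    have "F x \<in> space ?M" by (simp add: F_def space_PiM)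
    then show ?thesis by (auto simp: B_def enorm_le_1_iff F)
  qed
  have img: "(\<lambda>x. restrict x {..<n}) ` triangular_ellipsoid n T c = F -` B \<inter> space ?M"
  proof (intro equalityI subsetI)
    fix x assume "x \<in> (\<lambda>x. restrict x {..<n}) ` triangular_ellipsoid n T c"
    then obtain y where y: "y \<in> triangular_ellipsoid n T c" and x: "x = restrict y {..<n}"
      by blast
    have "mat_apply n T (\<lambda>i. x i - c i) = mat_apply n T (\<lambda>i. y i - c i)"
      by (rule mat_apply_cong) (simp add: x)
    then show "x \<in> F -` B \<inter> space ?M"
      unfolding FB using y by (simp add: triangular_ellipsoid_def space_PiM x)
  next
    fix x assume x: "x \<in> F -` B \<inter> space ?M"
    \<comment> \<open>Outside \<open>{..<n}\<close> the value \<open>undefined\<close> of the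
      product space is replaced by the 0 of \<open>Euclidean_space n\<close>.\<close>
    define y where "y = (\<lambda>i. if i < n then x i else 0)"
    have xy: "x = restrict y {..<n}"
      using x by (auto simp: space_PiM y_def fun_eq_iff PiE_def extensional_def)
    have "mat_apply n T (\<lambda>i. x i - c i) = mat_apply n T (\<lambda>i. y i - c i)"
      by (rule mat_apply_cong) (simp add: y_def)
    then have "y \<in> triangular_ellipsoid n T c"
      using x unfolding FB by (simp add: triangular_ellipsoid_def y_def topspace_Euclidean_space)
    with xy show "x \<in> (\<lambda>x. restrict x {..<n}) ` triangular_ellipsoid n T c"
      by (rule image_eqI)
  qed
  have "(\<integral>\<^sup>+x. indicator B (F x) \<partial>?M) = (\<integral>\<^sup>+x. indicator (F -` B \<inter> space ?M) x \<partial>?M)"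
    by (rule nn_integral_cong) (simp add: indicator_def)
  then have "ennreal (\<Prod>i<n. T i i) * emeasure ?M (F -` B \<inter> space ?M) =
      ennreal (\<Prod>i<n. T i i) * (\<integral>\<^sup>+x. indicator B (F x) \<partial>?M)"
    by simp
  also have "\<dots> = emeasure ?M B"
    unfolding F_def by (subst nn_integral_triangular[OF T]) auto
  also have "\<dots> = ennreal (unit_ball_vol n)"
    using emeasure_cball_aux[of "{..<n}" 1] by (simp add: B_def)
  finally have eq: "ennreal (\<Prod>i<n. T i i) * emeasure ?M (F -` B \<inter> space ?M) = ennreal (unit_ball_vol n)" .
  then have "(\<Prod>i<n. T i i) * measure ?M (F -` B \<inter> space ?M) = unit_ball_vol n"
    using p arg_cong[OF eq, of enn2real] by (subst (asm) enn2real_mult) (simp add: measure_def)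
  then have "measure ?M (F -` B \<inter> space ?M) * (\<Prod>i<n. T i i) = unit_ball_vol n"
    by (simp only: mult.commute)
  with p show ?thesis
    unfolding vol_def img by (metis eq_divide_imp less_irrefl)
qed

subsection \<open>Extremality of ellipsoids\<close>

text \<open>The inequality of arithmetic and geometric means with its equality case, both from
  \<open>ln a \<le> a - 1\<close>, where equality holds only at 1.\<close>

lemma prod_le_1_of_sum_le:
  fixes a :: "nat \<Rightarrow> real"
  assumes pos: "\<And>i. i < n \<Longrightarrow> 0 < a i" and sum: "(\<Sum>i<n. a i) \<le> n"
  shows "(\<Prod>i<n. a i) \<le> 1" and "(\<Prod>i<n. a i) = 1 \<Longrightarrow> i < n \<Longrightarrow> a i = 1"
proof -
  have ln: "ln (\<Prod>i<n. a i) = (\<Sum>i<n. ln (a i))"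
    by (rule ln_prod) (use pos in fastforce)+
  have prod: "0 < (\<Prod>i<n. a i)"
    by (rule prod_pos) (use pos in auto)
  have le: "ln (a i) \<le> a i - 1" if "i < n" for i
    using pos[OF that] by (rule ln_le_minus_one)
  have sum': "(\<Sum>i<n. a i - 1) \<le> 0"
    using sum by (simp add: sum_subtractf)
  have "ln (\<Prod>i<n. a i) \<le> (\<Sum>i<n. a i - 1)"
    unfolding ln by (rule sum_mono) (use le in auto)
  with sum' have "ln (\<Prod>i<n. a i) \<le> 0" by linarith
  then show "(\<Prod>i<n. a i) \<le> 1"
    using prod by (simp only: ln_le_zero_iff)
  assume 1: "(\<Prod>i<n. a i) = 1" and i: "i < n"
  \<comment> \<open>The logarithms sum to 0, so the nonnegative defects
    \<open>a i - 1 - ln (a i)\<close> have a sum that is at most 0.\<close>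
  have "(\<Sum>i<n. a i - 1 - ln (a i)) = (\<Sum>i<n. a i - 1)"
    using ln 1 by (simp add: sum_subtractf)
  then have "(\<Sum>i<n. a i - 1 - ln (a i)) = 0"
    using sum' le by (intro antisym sum_nonneg) auto
  then have "a i - 1 - ln (a i) = 0"
    using le i by (subst (asm) sum_nonneg_eq_0_iff) auto
  then show "a i = 1"
    using pos[OF i] ln_eq_minus_one[of "a i"] by simp
qed

definition diag_mat :: "(nat \<Rightarrow> real) \<Rightarrow> nat \<Rightarrow> nat \<Rightarrow> real" where
  "diag_mat d i j = (if i = j then d i else 0)"

lemma mat_apply_diag_mat: "mat_apply n (diag_mat d) x = (\<lambda>i. if i < n then d i * x i else 0)"
  by (auto simp: mat_apply_def diag_mat_def if_distrib[where f="\<lambda>y. y * _"] cong: if_cong)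

lemma lower_triangular_diag_mat: "(\<And>i. i < n \<Longrightarrow> 0 < d i) \<Longrightarrow> lower_triangular n (diag_mat d)"
  by (auto simp: lower_triangular_def diag_mat_def)

text \<open>Converse of the normal form for diagonal matrices; it certifies the two candidate
  ellipsoids.\<close>

lemma ellipsoid_at_diag:
  assumes d: "\<And>i. i < n \<Longrightarrow> 0 < d i" and c: "c \<in> topspace (Euclidean_space n)"
  shows "ellipsoid_at n c (triangular_ellipsoid n (diag_mat d) c)"
proof -
  let ?V = "topspace (Euclidean_space n)"
  define A where "A = diag_mat (\<lambda>i. inverse (d i))"
  have AD: "mat_apply n A (mat_apply n (diag_mat d) x) = x" if "x \<in> ?V" for x
    using that d by (force simp: A_def mat_apply_diag_mat topspace_Euclidean_space fun_eq_iff)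
  have DA: "mat_apply n (diag_mat d) (mat_apply n A x) = x" if "x \<in> ?V" for x
    using that d by (force simp: A_def mat_apply_diag_mat topspace_Euclidean_space fun_eq_iff)
  have "bij_betw (mat_apply n A) ?V ?V"
    by (rule bij_betw_byWitness[where f'="mat_apply n (diag_mat d)"]) (use AD DA in auto)
  moreover have "triangular_ellipsoid n (diag_mat d) c = (\<lambda>u i. c i + mat_apply n A u i) ` unit_ball n"
  proof (intro equalityI subsetI)
    fix x assume x: "x \<in> triangular_ellipsoid n (diag_mat d) c"
    define u where "u = mat_apply n (diag_mat d) (\<lambda>i. x i - c i)"
    have "(\<lambda>i. x i - c i) \<in> ?V"
      using x c by (simp add: triangular_ellipsoid_def topspace_Euclidean_space)
    from AD[OF this] have "x = (\<lambda>i. c i + mat_apply n A u i)"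
      by (simp add: u_def)
    moreover have "u \<in> unit_ball n"
      using x by (simp add: unit_ball_def triangular_ellipsoid_def u_def)
    ultimately show "x \<in> (\<lambda>u i. c i + mat_apply n A u i) ` unit_ball n"
      by (rule image_eqI)
  next
    fix x assume "x \<in> (\<lambda>u i. c i + mat_apply n A u i) ` unit_ball n"
    then obtain u where u: "u \<in> unit_ball n" "x = (\<lambda>i. c i + mat_apply n A u i)"
      by blast
    then have "mat_apply n (diag_mat d) (\<lambda>i. x i - c i) = u"
      using DA by (simp add: unit_ball_def)
    moreover have "x \<in> ?V"
      using c mat_apply_in_space[of n A u] by (simp add: topspace_Euclidean_space u(2))
    ultimately show "x \<in> triangular_ellipsoid n (diag_mat d) c"
      using u by (simp add: triangular_ellipsoid_def unit_ball_def)
  qed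
  ultimately show ?thesis
    unfolding ellipsoid_at_def using c by blast
qed

lemma unit_ball_eq_triangular: "unit_ball n = triangular_ellipsoid n (diag_mat (\<lambda>_. 1)) (\<lambda>_. 0)"
  by (auto simp: triangular_ellipsoid_def unit_ball_def mat_apply_diag_mat enorm_le_1_iff)

section \<open>Criteria for the Loewner and John centers\<close>

lemma loewner_center_eqI:
  assumes E0: "ellipsoid_at n c0 E0" "K \<subseteq> E0"
    and min: "\<And>c E. ellipsoid_at n c E \<Longrightarrow> K \<subseteq> E \<Longrightarrow> vol n E0 \<le> vol n E"
    and unique: "\<And>c E. ellipsoid_at n c E \<Longrightarrow> K \<subseteq> E \<Longrightarrow> vol n E = vol n E0 \<Longrightarrow> E = E0 \<and> c = c0"
  shows "loewner_center n K = c0"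
proof -
  have "loewner_ellipsoid n K = E0"
    unfolding loewner_ellipsoid_def
  proof (rule the_equality)
    fix E assume E: "ellipsoid n E \<and> K \<subseteq> E \<and> (\<forall>E'. ellipsoid n E' \<and> K \<subseteq> E' \<longrightarrow> vol n E \<le> vol n E')"
    then obtain c where c: "ellipsoid_at n c E" by (auto simp: ellipsoid_def)
    have "vol n E = vol n E0"
      using E E0 min[OF c] by (intro antisym) (auto simp: ellipsoid_def)
    then show "E = E0" using unique[OF c] E by blast
  qed (use E0 min in \<open>auto simp: ellipsoid_def\<close>)
  moreover have "ellipsoid_center n E0 = c0"
    unfolding ellipsoid_center_def by (rule the_equality) (use E0 unique in blast)+
  ultimately show ?thesis
    by (simp add: loewner_center_def)
qed

text \<open>Both the ellipsoid and its center are definite descriptions. Uniqueness is therefore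
  required of the pair: applied to \<open>E0\<close> itself it shows that \<open>E0\<close> has only
  one center.\<close>

lemma john_center_eqI:
  assumes E0: "ellipsoid_at n c0 E0" "E0 \<subseteq> K"
    and max: "\<And>c E. ellipsoid_at n c E \<Longrightarrow> E \<subseteq> K \<Longrightarrow> vol n E \<le> vol n E0"
    and unique: "\<And>c E. ellipsoid_at n c E \<Longrightarrow> E \<subseteq> K \<Longrightarrow> vol n E = vol n E0 \<Longrightarrow> E = E0 \<and> c = c0"
  shows "john_center n K = c0"
proof -
  have "john_ellipsoid n K = E0"
    unfolding john_ellipsoid_def
  proof (rule the_equality)
    fix E assume E: "ellipsoid n E \<and> E \<subseteq> K \<and> (\<forall>E'. ellipsoid n E' \<and> E' \<subseteq> K \<longrightarrow> vol n E' \<le> vol n E)"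
    then obtain c where c: "ellipsoid_at n c E" by (auto simp: ellipsoid_def)
    have "vol n E = vol n E0"
      using E E0 max[OF c] by (intro antisym) (auto simp: ellipsoid_def)
    then show "E = E0" using unique[OF c] E by blast
  qed (use E0 max in \<open>auto simp: ellipsoid_def\<close>)
  moreover have "ellipsoid_center n E0 = c0"
    unfolding ellipsoid_center_def by (rule the_equality) (use E0 unique in blast)+
  ultimately show ?thesis
    by (simp add: john_center_def)
qed

text \<open>
  This replaces the averaging over all sign vectors: choosing the signs one after the other so that
  each new cross term is nonnegative makes the sum of squares at least its average.
\<close>

lemma exists_signs_sum_squares_ge:
  fixes v :: "nat \<Rightarrow> real" and b :: "nat \<Rightarrow> nat \<Rightarrow> real"
  assumes "finite J"
  shows "\<exists>w. (\<forall>j. w j = 1 \<or> w j = - 1) \<and>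
    (\<Sum>i<n. (v i)\<^sup>2) + (\<Sum>j\<in>J. \<Sum>i<n. (b i j)\<^sup>2) \<le> (\<Sum>i<n. (v i + (\<Sum>j\<in>J. b i j * w j))\<^sup>2)"
  using assms
proof (induction J)
  case empty
  show ?case by (rule exI[of _ "\<lambda>_. 1"]) simp
next
  case (insert k J)
  then obtain w :: point where w: "\<And>j. w j = 1 \<or> w j = - 1"
    "(\<Sum>i<n. (v i)\<^sup>2) + (\<Sum>j\<in>J. \<Sum>i<n. (b i j)\<^sup>2) \<le> (\<Sum>i<n. (v i + (\<Sum>j\<in>J. b i j * w j))\<^sup>2)"
    by blast
  define u where "u i = v i + (\<Sum>j\<in>J. b i j * w j)" for i
  define s where "s = (if 0 \<le> (\<Sum>i<n. u i * b i k) then 1 else - 1 :: real)"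
  have s: "s\<^sup>2 = 1" "s = 1 \<or> s = - 1" "0 \<le> s * (\<Sum>i<n. u i * b i k)"
    by (auto simp: s_def)
  define w' where "w' = w(k := s)"
  have "(\<Sum>j\<in>J. b i j * w' j) = (\<Sum>j\<in>J. b i j * w j)" for i
    using insert(1,2) by (intro sum.cong) (auto simp: w'_def)
  then have "v i + (\<Sum>j\<in>insert k J. b i j * w' j) = u i + s * b i k" for i
    using insert(1,2) by (simp add: u_def w'_def)
  then have "(\<Sum>i<n. (v i + (\<Sum>j\<in>insert k J. b i j * w' j))\<^sup>2) = (\<Sum>i<n. (u i + s * b i k)\<^sup>2)"
    by simp
  also have "\<dots> = (\<Sum>i<n. (u i)\<^sup>2) + 2 * (s * (\<Sum>i<n. u i * b i k)) + (\<Sum>i<n. (b i k)\<^sup>2)"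
    using s(1) by (simp add: power2_sum power_mult_distrib sum.distrib sum_distrib_left algebra_simps)
  finally have "(\<Sum>i<n. (v i)\<^sup>2) + (\<Sum>j\<in>insert k J. \<Sum>i<n. (b i j)\<^sup>2)
      \<le> (\<Sum>i<n. (v i + (\<Sum>j\<in>insert k J. b i j * w' j))\<^sup>2)"
    using s(3) w(2) insert(1,2) by (simp add: u_def)
  moreover have "\<forall>j. w' j = 1 \<or> w' j = - 1"
    using w(1) s(2) by (simp add: w'_def)
  ultimately show ?case by blast
qed

text \<open>The vertices of a cube of half-width \<open>r\<close> in the hyperplane at height
  \<open>t\<close>.\<close>

definition sign_point :: "nat \<Rightarrow> real \<Rightarrow> real \<Rightarrow> (nat \<Rightarrow> real) \<Rightarrow> point" where
  "sign_point n t r w i = (if i = 0 then t else if i < n then r * w i else 0)"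

lemma sum_lessThan_split_0: "0 < n \<Longrightarrow> (\<Sum>i<n. f i) = f 0 + (\<Sum>i = 1..<n. f i :: real)" for n :: nat
  by (simp add: atLeast0LessThan[symmetric] sum.atLeast_Suc_lessThan)

text \<open>The left side is the mean of the squared norm of \<open>T (x - c)\<close> over all sign
  vectors. Some sign vector attains at least this mean, and its value is at most 1.\<close>

lemma sign_points_in_ellipsoid:
  assumes n: "0 < n"
    and le: "\<And>w. (\<forall>j. w j = 1 \<or> w j = - 1) \<Longrightarrow>
      enorm n (mat_apply n T (\<lambda>i. sign_point n t r w i - c i)) \<le> 1"
  shows "(\<Sum>i<n. (T i 0 * t - mat_apply n T c i)\<^sup>2) + r\<^sup>2 * (\<Sum>j = 1..<n. \<Sum>i<n. (T i j)\<^sup>2) \<le> 1"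
proof -
  obtain w where w: "\<forall>j. w j = 1 \<or> w j = - 1"
    "(\<Sum>i<n. (T i 0 * t - mat_apply n T c i)\<^sup>2) + (\<Sum>j = 1..<n. \<Sum>i<n. (r * T i j)\<^sup>2) \<le>
     (\<Sum>i<n. (T i 0 * t - mat_apply n T c i + (\<Sum>j = 1..<n. r * T i j * w j))\<^sup>2)"
    using exists_signs_sum_squares_ge[where J="{1..<n}" and n=n
        and v="\<lambda>i. T i 0 * t - mat_apply n T c i" and b="\<lambda>i j. r * T i j"]
    by auto
  have "(\<Sum>i<n. (T i 0 * t - mat_apply n T c i + (\<Sum>j = 1..<n. r * T i j * w j))\<^sup>2)
      = (\<Sum>i<n. (mat_apply n T (\<lambda>i. sign_point n t r w i - c i) i)\<^sup>2)"
  proof (rule sum.cong[OF refl])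
    fix i assume "i \<in> {..<n}"
    then have "mat_apply n T (\<lambda>i. sign_point n t r w i - c i) i
        = (\<Sum>j<n. T i j * sign_point n t r w j) - mat_apply n T c i"
      by (simp add: mat_apply_def right_diff_distrib sum_subtractf)
    also have "(\<Sum>j<n. T i j * sign_point n t r w j) = T i 0 * t + (\<Sum>j = 1..<n. r * T i j * w j)"
      unfolding sum_lessThan_split_0[OF n]
      by (intro arg_cong2[where f="(+)"] sum.cong) (auto simp: sign_point_def)
    finally show "(T i 0 * t - mat_apply n T c i + (\<Sum>j = 1..<n. r * T i j * w j))\<^sup>2
        = (mat_apply n T (\<lambda>i. sign_point n t r w i - c i) i)\<^sup>2"
      by (simp add: diff_add_eq)
  qed
  also have "\<dots> \<le> 1"
    using le[OF w(1)] by (simp add: enorm_le_1_iff)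
  finally show ?thesis
    using w(2) by (simp add: power_mult_distrib sum_distrib_left)
qed

subsection \<open>The convex body and its Loewner ellipsoid\<close>

text \<open>The length of the axis segment from \<open>-2/n\<close> to \<open>1/2\<close>.\<close>

definition height :: "nat \<Rightarrow> real" where
  "height n = 1 / 2 + 2 / n"

definition profile :: "nat \<Rightarrow> real \<Rightarrow> real" where
  "profile n t = 1 / 2 - (1 / 2 - t) / (8 * height n)"

text \<open>
  The slope of \<^term>\<open>profile n\<close> is chosen such that its value at \<open>-2/n\<close> is three quarters of its
  value at \<open>1/2\<close>: truncating the cone there puts the John center at relative distance
  \<open>4/(n+1)\<close> from the top.
\<close>

definition body :: "nat \<Rightarrow> point set" where
  "body n = {x \<in> topspace (Euclidean_space n). (\<Sum>i<n. (x i)\<^sup>2) \<le> 1 \<and>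
     - (2 / n) \<le> x 0 \<and> x 0 \<le> 1 / 2 \<and> (\<forall>i\<in>{1..<n}. \<bar>x i\<bar> \<le> profile n (x 0))}"

lemma sign_point_in_body:
  assumes n: "0 < n" and w: "\<forall>j. w j = 1 \<or> w j = - 1"
    and t: "- (2 / n) \<le> t" "t \<le> 1 / 2" and r: "0 \<le> r" "r \<le> profile n t" "t\<^sup>2 + (real n - 1) * r\<^sup>2 \<le> 1"
  shows "sign_point n t r w \<in> body n"
proof -
  have w2: "(w j)\<^sup>2 = 1" "\<bar>w j\<bar> = 1" for j
    using w[rule_format, of j] by auto
  have "(\<Sum>i<n. (sign_point n t r w i)\<^sup>2) = t\<^sup>2 + (\<Sum>i = 1..<n. r\<^sup>2)"
    unfolding sum_lessThan_split_0[OF n]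
    by (intro arg_cong2[where f="(+)"] sum.cong) (auto simp: sign_point_def power_mult_distrib w2)
  also have "\<dots> \<le> 1"
    using r n by (simp add: of_nat_diff)
  finally show ?thesis
    using t r n w2 by (auto simp: body_def sign_point_def topspace_Euclidean_space abs_mult)
qed

lemma profile_bottom: "0 < n \<Longrightarrow> profile n (- (2 / n)) = 3 / 8"
proof -
  assume "0 < n"
  then have "0 < height n" by (simp add: height_def add_pos_nonneg)
  then show ?thesis by (simp add: profile_def height_def[symmetric])
qed

lemma profile_top: "profile n (1 / 2) = 1 / 2"
  by (simp add: profile_def)

text \<open>The points on the sphere at heights \<open>-2/n\<close> and \<open>1/2\<close>, weighted
  \<open>n : 4\<close>, have mean 0 and second moment matrix \<open>1/n\<close> times the identity.
  Averaging the squared norm of \<open>T (x - c)\<close> over them gives the bound.\<close>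

lemma loewner_frobenius_bound:
  assumes n: "100 \<le> n" and K: "\<And>x. x \<in> body n \<Longrightarrow> enorm n (mat_apply n T (\<lambda>i. x i - c i)) \<le> 1"
  shows "(\<Sum>j<n. \<Sum>i<n. (T i j)\<^sup>2) + n * (\<Sum>i<n. (mat_apply n T c i)\<^sup>2) \<le> n"
proof -
  define N where "N = real n"
  have N: "100 \<le> N" using n by (simp add: N_def)
  have n0: "0 < n" using n by simp
  have "0 \<le> 2 / N" using N by simp
  define a where "a = (\<Sum>i<n. (T i 0)\<^sup>2)"
  define e where "e = (\<Sum>i<n. T i 0 * mat_apply n T c i)"
  define D where "D = (\<Sum>i<n. (mat_apply n T c i)\<^sup>2)"
  define F where "F = (\<Sum>j = 1..<n. \<Sum>i<n. (T i j)\<^sup>2)"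
  have expand: "(\<Sum>i<n. (T i 0 * t - mat_apply n T c i)\<^sup>2) = t\<^sup>2 * a - 2 * t * e + D" for t
    by (simp add: power2_diff power_mult_distrib a_def e_def D_def sum.distrib sum_subtractf
        sum_distrib_left mult.commute mult.left_commute)
  \<comment> \<open>Here \<open>q\<close> is the square of the half-width \<open>r\<close> of the
    sign points.\<close>
  have bound: "t\<^sup>2 * a - 2 * t * e + D + q * F \<le> 1"
    if "- (2 / N) \<le> t" "t \<le> 1 / 2" "0 \<le> q" "q \<le> (profile n t)\<^sup>2" "0 \<le> profile n t" "t\<^sup>2 + (N - 1) * q \<le> 1" for t q
  proof -
    have "sqrt q \<le> profile n t"
      using that by (simp add: real_le_lsqrt)
    then have "sign_point n t (sqrt q) w \<in> body n" if "\<forall>j. w j = 1 \<or> w j = - 1" for w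
      using \<open>- (2 / N) \<le> t\<close> \<open>t \<le> 1 / 2\<close> \<open>0 \<le> q\<close> \<open>t\<^sup>2 + (N - 1) * q \<le> 1\<close> that n0
      by (intro sign_point_in_body) (auto simp: N_def)
    from sign_points_in_ellipsoid[OF n0 K[OF this]] show ?thesis
      using \<open>0 \<le> q\<close> by (simp add: expand F_def)
  qed
  have bottom: "4 / N\<^sup>2 * a + 4 / N * e + D + (1 - 4 / N\<^sup>2) / (N - 1) * F \<le> 1"
  proof -
    have p: "profile n (- (2 / N)) = 3 / 8"
      using profile_bottom[OF n0] by (simp add: N_def)
    have N2: "4 / N\<^sup>2 \<le> 1"
    proof -
      have "2\<^sup>2 \<le> N\<^sup>2" using N by (intro power_mono) auto
      then show ?thesis using N by (simp add: divide_le_eq)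
    qed
    \<comment> \<open>With \<open>t = -2/n\<close> this is \<open>(1 - t^2) / (n - 1)\<close>, which
      puts the sign points on the unit sphere.\<close>
    define q where "q = (1 - 4 / N\<^sup>2) / (N - 1)"
    have "q \<le> 1 / (N - 1)"
      unfolding q_def using N by (intro divide_right_mono) auto
    also have "\<dots> \<le> (3 / 8)\<^sup>2"
      using N by (simp add: field_simps power2_eq_square)
    finally have q: "q \<le> (profile n (- (2 / N)))\<^sup>2" unfolding p .
    have q0: "0 \<le> q"
      using N N2 by (simp add: q_def)
    have norm: "(- (2 / N))\<^sup>2 + (N - 1) * q \<le> 1"
      using N by (simp add: q_def power_divide)
    have "- (2 / N) \<le> 1 / 2" using \<open>0 \<le> 2 / N\<close> by linarith
    from bound[OF order.refl this q0 q _ norm]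
    have "(- (2 / N))\<^sup>2 * a - 2 * (- (2 / N)) * e + D + q * F \<le> 1"
      unfolding p by simp
    moreover have "(- (2 / N))\<^sup>2 = 4 / N\<^sup>2"
      by (simp add: power_divide)
    ultimately show ?thesis
      by (simp add: q_def)
  qed
  have top: "1 / 4 * a - e + D + (3 / 4) / (N - 1) * F \<le> 1"
  proof -
    \<comment> \<open>Again \<open>(1 - t^2) / (n - 1)\<close>, now with
      \<open>t = 1/2\<close>.\<close>
    define q where "q = (3 / 4) / (N - 1)"
    have "q \<le> (profile n (1 / 2))\<^sup>2"
      using N by (simp add: q_def profile_top field_simps power2_eq_square)
    moreover have "N - 1 \<noteq> 0" using N by simp
    then have "(N - 1) * q = 3 / 4"
      by (subst q_def) (metis nonzero_mult_div_cancel_left times_divide_eq_right)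
    moreover have "0 \<le> q"
      using N by (simp add: q_def)
    moreover have "- (2 / N) \<le> 1 / 2"
      using \<open>0 \<le> 2 / N\<close> by linarith
    ultimately have "(1 / 2)\<^sup>2 * a - 2 * (1 / 2) * e + D + q * F \<le> 1"
      by (intro bound) (simp_all add: profile_top power_divide)
    then show ?thesis
      by (simp add: q_def power_divide)
  qed
  \<comment> \<open>The weights \<open>n : 4\<close> of the two heights make their weighted mean \<open>0\<close>, so \<open>e\<close> cancels.\<close>
  have "N\<^sup>2 * (4 / N\<^sup>2 * a + 4 / N * e + D + (1 - 4 / N\<^sup>2) / (N - 1) * F)
      + 4 * N * (1 / 4 * a - e + D + (3 / 4) / (N - 1) * F) \<le> N\<^sup>2 * 1 + 4 * N * 1"
    using N by (intro add_mono mult_left_mono bottom top) auto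
  moreover have "N\<^sup>2 * (4 / N\<^sup>2 * a + 4 / N * e + D + (1 - 4 / N\<^sup>2) / (N - 1) * F)
      + 4 * N * (1 / 4 * a - e + D + (3 / 4) / (N - 1) * F) = (N + 4) * (a + F + N * D)"
  proof -
    define k where "k = F / (N - 1)"
    have "N\<^sup>2 * (1 - 4 / N\<^sup>2) = N\<^sup>2 - 4"
      using N by (simp add: right_diff_distrib)
    then have "N\<^sup>2 * ((1 - 4 / N\<^sup>2) / (N - 1) * F) = (N\<^sup>2 - 4) * k"
      by (simp add: k_def)
    moreover have "4 * N * ((3 / 4) / (N - 1) * F) = 3 * N * k"
      using N by (simp add: k_def field_simps)
    moreover have "(N - 1) * k = F"
      using N by (simp add: k_def)
    then have "(N\<^sup>2 - 4) * k + 3 * N * k = (N + 4) * F"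
      by (auto simp: algebra_simps power2_eq_square)
    ultimately have "N\<^sup>2 * ((1 - 4 / N\<^sup>2) / (N - 1) * F) + 4 * N * ((3 / 4) / (N - 1) * F) = (N + 4) * F"
      by simp
    moreover have "N\<^sup>2 * (4 / N\<^sup>2 * a + 4 / N * e + D) + 4 * N * (1 / 4 * a - e + D) = (N + 4) * (a + N * D)"
      using N by (simp add: field_simps power2_eq_square)
    ultimately show ?thesis
      by (simp only: distrib_left distrib_right)
  qed
  ultimately have "(N + 4) * (a + F + N * D) \<le> (N + 4) * N"
    by (simp add: algebra_simps power2_eq_square)
  then have "a + F + N * D \<le> N"
    using N by (simp add: mult_le_cancel_left)
  then show ?thesis
    by (simp add: a_def F_def D_def N_def sum_lessThan_split_0[OF n0, of "\<lambda>j. \<Sum>i<n. (T i j)\<^sup>2"])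
qed

text \<open>The Frobenius bound limits the sum of the squared diagonal entries by \<open>n\<close>,
  so their product is at most 1 and the volume is at least that of the unit ball.\<close>

lemma loewner_center_body:
  assumes n: "100 \<le> n"
  shows "loewner_center n (body n) = (\<lambda>_. 0)"
proof (rule loewner_center_eqI)
  let ?V = "topspace (Euclidean_space n)"
  have 0: "(\<lambda>_. 0) \<in> ?V" by (simp add: topspace_Euclidean_space)
  have vol0: "vol n (unit_ball n) = unit_ball_vol n"
    unfolding unit_ball_eq_triangular using 0
    by (subst vol_triangular_ellipsoid) (auto intro: lower_triangular_diag_mat simp: diag_mat_def)
  show "ellipsoid_at n (\<lambda>_. 0) (unit_ball n)"
    unfolding unit_ball_eq_triangular by (rule ellipsoid_at_diag) (use 0 in auto)
  show "body n \<subseteq> unit_ball n"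
    by (auto simp: body_def unit_ball_def enorm_le_1_iff)
  fix c E assume E: "ellipsoid_at n c E" "body n \<subseteq> E"
  then have c: "c \<in> ?V" by (simp add: ellipsoid_at_def)
  obtain T where T: "lower_triangular n T" and ET: "E = triangular_ellipsoid n T c"
    using ellipsoid_at_imp_triangular[OF E(1)] by blast
  have pos: "0 < T i i" and upper: "i < j \<Longrightarrow> T i j = 0" if "i < n" for i j
    using T that by (auto simp: lower_triangular_def)
  have pos2: "0 < (T i i)\<^sup>2" if "i < n" for i
    using pos[OF that] by (rule zero_less_power)
  define P where "P = (\<Prod>i<n. T i i)"
  have P: "0 < P" unfolding P_def using pos by (intro prod_pos) auto
  have volE: "vol n E = unit_ball_vol n / P"
    unfolding ET P_def by (rule vol_triangular_ellipsoid[OF T c])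
  have frob: "(\<Sum>j<n. \<Sum>i<n. (T i j)\<^sup>2) + n * (\<Sum>i<n. (mat_apply n T c i)\<^sup>2) \<le> n"
    by (rule loewner_frobenius_bound[OF n]) (use E(2) in \<open>auto simp: ET triangular_ellipsoid_def\<close>)
  define off where "off j = (\<Sum>i\<in>{..<n} - {j}. (T i j)\<^sup>2)" for j
  have split: "(\<Sum>i<n. (T i j)\<^sup>2) = (T j j)\<^sup>2 + off j" if "j < n" for j
    using that by (simp add: off_def sum.remove)
  have off: "0 \<le> off j" for j by (simp add: off_def sum_nonneg)
  have norm: "0 \<le> real n * (\<Sum>i<n. (mat_apply n T c i)\<^sup>2)" by (simp add: sum_nonneg)
  have "(\<Sum>j<n. \<Sum>i<n. (T i j)\<^sup>2) = (\<Sum>j<n. (T j j)\<^sup>2) + (\<Sum>j<n. off j)"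
    by (simp add: split sum.distrib)
  with frob have sum: "(\<Sum>j<n. (T j j)\<^sup>2) + (\<Sum>j<n. off j) + n * (\<Sum>i<n. (mat_apply n T c i)\<^sup>2) \<le> n"
    by simp
  moreover have "0 \<le> (\<Sum>j<n. off j)" by (simp add: off sum_nonneg)
  ultimately have sum1: "(\<Sum>j<n. (T j j)\<^sup>2) \<le> n" using norm by linarith
  have P2: "(\<Prod>i<n. (T i i)\<^sup>2) = P\<^sup>2" by (simp add: P_def prod_power_distrib)
  have "P\<^sup>2 \<le> 1"
    unfolding P2[symmetric] by (rule prod_le_1_of_sum_le(1)[OF pos2 sum1])
  then have "P \<le> 1" using P by (simp add: power_le_one_iff)
  then show "vol n (unit_ball n) \<le> vol n E"
    unfolding vol0 volE using P by (simp add: le_divide_eq mult_left_le)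
  assume "vol n E = vol n (unit_ball n)"
  then have "unit_ball_vol n / P = unit_ball_vol n" by (simp add: vol0 volE)
  moreover have "unit_ball_vol n \<noteq> 0" using unit_ball_vol_pos[of n] by linarith
  ultimately have "P = 1" using P by (simp add: divide_eq_eq)
  have prod1: "(\<Prod>i<n. (T i i)\<^sup>2) = 1"
    unfolding P2 by (subst \<open>P = 1\<close>) simp
  have one: "T i i = 1" if "i < n" for i
  proof -
    have "(T i i)\<^sup>2 = 1"
      by (rule prod_le_1_of_sum_le(2)[OF pos2 sum1 prod1 that])
    then show ?thesis
      using pos[OF that] by (simp add: power2_eq_1_iff)
  qed
  \<comment> \<open>The diagonal alone exhausts the bound \<open>n\<close>, which leaves nothing for
    the off-diagonal entries and for \<open>T c\<close>.\<close>
  then have "(\<Sum>j<n. (T j j)\<^sup>2) = n" by simp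
  with sum have "(\<Sum>j<n. off j) + n * (\<Sum>i<n. (mat_apply n T c i)\<^sup>2) \<le> 0" by simp
  with norm \<open>0 \<le> (\<Sum>j<n. off j)\<close> have "(\<Sum>j<n. off j) = 0" "real n * (\<Sum>i<n. (mat_apply n T c i)\<^sup>2) = 0"
    by linarith+
  then have "off j = 0" if "j < n" for j
    using that off by (subst (asm) sum_nonneg_eq_0_iff) auto
  then have "T i j = 0" if "i < n" "j < n" "i \<noteq> j" for i j
    using that by (auto simp: off_def sum_nonneg_eq_0_iff)
  with one have "mat_apply n T x = mat_apply n (diag_mat (\<lambda>_. 1)) x" for x
    by (auto simp: mat_apply_def diag_mat_def fun_eq_iff intro!: sum.cong)
  moreover have "(mat_apply n T c i)\<^sup>2 = 0" if "i < n" for i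
    using \<open>real n * (\<Sum>i<n. (mat_apply n T c i)\<^sup>2) = 0\<close> that n by (auto simp: sum_nonneg_eq_0_iff)
  ultimately have "c i = 0" if "i < n" for i
    using that by (simp add: mat_apply_diag_mat)
  then have "c = (\<lambda>_. 0)"
    using c by (auto simp: topspace_Euclidean_space fun_eq_iff) (meson not_less)
  then show "E = unit_ball n \<and> c = (\<lambda>_. 0)"
    by (simp add: ET unit_ball_eq_triangular triangular_ellipsoid_def
        \<open>\<And>x. mat_apply n T x = mat_apply n (diag_mat (\<lambda>_. 1)) x\<close>)
qed

subsection \<open>The John ellipsoid of the body\<close>

text \<open>Semi-axes of the John ellipsoid of the full cone: its base is a cube of half-width
  \<open>1/2\<close> at \<open>x 0 = 1/2\<close>, and its height is \<open>4 * height n\<close>,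
  since \<open>profile n\<close> vanishes that far below the base.\<close>

definition john_axis :: "nat \<Rightarrow> nat \<Rightarrow> real" where
  "john_axis n i = (if i = 0 then 4 * height n / (n + 1) else sqrt ((real n - 1) / (n + 1)) / 2)"

definition john_point :: "nat \<Rightarrow> point" where
  "john_point n i = (if i = 0 then 1 / 2 - john_axis n 0 else 0)"

lemma height_pos [simp]: "0 < height n"
  by (simp add: height_def add_pos_nonneg)

lemma john_axis_pos: "2 \<le> n \<Longrightarrow> 0 < john_axis n i"
  using height_pos[of n] by (auto simp: john_axis_def)

text \<open>Keeps the ellipsoid in the half-space \<open>0 \<le> x 0\<close>, away from the
  truncation of the cone, and its center off the origin.\<close>

lemma john_axis_0_le:
  assumes "100 \<le> n"
  shows "john_axis n 0 \<le> 1 / 4"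
proof -
  have "2 / real n \<le> 1" using assms by simp
  then have "4 * height n \<le> 1 / 4 * (real n + 1)"
    using assms unfolding height_def by (simp only: distrib_left)
  then show ?thesis
    by (simp add: john_axis_def divide_le_eq)
qed

text \<open>The change of \<open>profile n\<close> along the vertical semi-axis.\<close>

lemma john_axis_0_slope: "john_axis n 0 / (8 * height n) = 1 / (2 * (real n + 1))"
proof -
  have "4 * height n / M / (8 * height n) = 1 / (2 * M)" for M
    using height_pos[of n] by (auto simp: divide_simps simp del: height_pos)
  then show ?thesis by (simp add: john_axis_def add.commute)
qed

lemma john_axis_square: "1 \<le> n \<Longrightarrow> 0 < i \<Longrightarrow> (john_axis n i)\<^sup>2 = (real n - 1) / (4 * (real n + 1))"
  by (simp add: john_axis_def power_divide)

text \<open>Tangency to the lateral facets: the left side is the squared maximum of the linear part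
  of \<open>x i - profile n (x 0)\<close> over the centered ellipsoid, the right side the squared
  half-width of the cone at the center.\<close>

lemma john_axes_pythagoras:
  assumes "1 \<le> n" "0 < i"
  shows "(john_axis n i)\<^sup>2 + (1 / (2 * (real n + 1)))\<^sup>2 = (real n / (2 * (real n + 1)))\<^sup>2"
proof -
  define M where "M = real n + 1"
  have "0 < M" by (simp add: M_def)
  have sq: "(john_axis n i)\<^sup>2 = (M - 2) / (4 * M)"
    using john_axis_square[OF assms] by (simp add: M_def)
  have n: "real n = M - 1" by (simp add: M_def)
  show ?thesis
    unfolding sq n using \<open>0 < M\<close> by (simp add: field_simps power2_eq_square)
qed

lemma profile_john_point: "profile n (john_point n 0) = n / (2 * (real n + 1))"
proof -
  have "profile n (john_point n 0) = 1 / 2 - john_axis n 0 / (8 * height n)"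
    by (simp add: profile_def john_point_def)
  then show ?thesis
    unfolding john_axis_0_slope by (simp add: field_simps)
qed

text \<open>In the normalized coordinates \<open>v\<close> of the unit ball, the lateral constraints
  follow from Cauchy-Schwarz and the tangency relation.\<close>

lemma john_ellipsoid_subset_body:
  assumes n: "100 \<le> n"
  shows "triangular_ellipsoid n (diag_mat (\<lambda>i. inverse (john_axis n i))) (john_point n) \<subseteq> body n"
proof
  fix x assume x: "x \<in> triangular_ellipsoid n (diag_mat (\<lambda>i. inverse (john_axis n i))) (john_point n)"
  have n0: "0 < n" using n by simp
  define v where "v i = inverse (john_axis n i) * (x i - john_point n i)" for i
  have xv: "x i = john_point n i + john_axis n i * v i" for i
  proof -
    have "john_axis n i \<noteq> 0" using john_axis_pos[of n i] n by simp
    then show ?thesis unfolding v_def by (simp only: mult.assoc[symmetric] right_inverse) simp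
  qed
  have sum: "(\<Sum>i<n. (v i)\<^sup>2) \<le> 1"
    using x by (simp add: triangular_ellipsoid_def enorm_le_1_iff mat_apply_diag_mat v_def)
  then have sum': "(v 0)\<^sup>2 + (\<Sum>i = 1..<n. (v i)\<^sup>2) \<le> 1"
    by (simp only: sum_lessThan_split_0[OF n0])
  have nonneg: "0 \<le> (\<Sum>i = 1..<n. (v i)\<^sup>2)" by (rule sum_nonneg) simp
  have "(v 0)\<^sup>2 \<le> 1" using sum' nonneg by linarith
  then have v0: "\<bar>v 0\<bar> \<le> 1" by (simp add: abs_square_le_1)
  define \<alpha> where "\<alpha> = john_axis n 0"
  have \<alpha>: "0 < \<alpha>" "\<alpha> \<le> 1 / 4"
    using john_axis_pos[of n 0] john_axis_0_le[OF n] n by (simp_all add: \<alpha>_def)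
  have x0: "x 0 = 1 / 2 - \<alpha> + \<alpha> * v 0"
    by (simp add: xv john_point_def \<alpha>_def)
  have "\<bar>\<alpha> * v 0\<bar> \<le> \<alpha>"
    using v0 \<alpha> by (simp add: abs_mult mult_left_le)
  then have x0_le: "x 0 \<le> 1 / 2" and x0_ge: "0 \<le> x 0"
    using \<alpha> unfolding x0 by linarith+
  \<comment> \<open>Lateral semi-axes of at most \<open>1/2\<close> bound the lateral part of the
    squared norm by \<open>1/4\<close>; the axial part is at most \<open>1/4\<close> as
    well.\<close>
  have "(john_axis n 1)\<^sup>2 \<le> 1 / 4"
    using n by (subst john_axis_square) (auto simp: divide_le_eq)
  have xi: "x i = john_axis n 1 * v i" if "0 < i" for i
    using that by (simp add: xv john_point_def john_axis_def)
  have "(\<Sum>i = 1..<n. (x i)\<^sup>2) = (john_axis n 1)\<^sup>2 * (\<Sum>i = 1..<n. (v i)\<^sup>2)"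
    by (simp add: xi power_mult_distrib sum_distrib_left)
  also have "\<dots> \<le> 1 / 4 * 1"
  proof (rule mult_mono)
    show "(\<Sum>i = 1..<n. (v i)\<^sup>2) \<le> 1" using sum' zero_le_power2[of "v 0"] by linarith
  qed (use \<open>(john_axis n 1)\<^sup>2 \<le> 1 / 4\<close> nonneg in simp_all)
  finally have "(\<Sum>i = 1..<n. (x i)\<^sup>2) \<le> 1 / 4" by simp
  moreover have "(x 0)\<^sup>2 \<le> (1 / 2)\<^sup>2"
    using x0_le x0_ge by (rule power_mono)
  ultimately have "(\<Sum>i<n. (x i)\<^sup>2) \<le> 1"
    by (simp add: sum_lessThan_split_0[OF n0] power_divide)
  moreover have "\<bar>x i\<bar> \<le> profile n (x 0)" if i: "i \<in> {1..<n}" for i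
  proof -
    define \<beta> where "\<beta> = john_axis n i"
    define \<gamma> where "\<gamma> = 1 / (2 * (real n + 1))"
    define R where "R = real n / (2 * (real n + 1))"
    have i0: "0 < i" using i by simp
    have pyth: "\<beta>\<^sup>2 + \<gamma>\<^sup>2 = R\<^sup>2"
      using john_axes_pythagoras[of n i] i n by (simp add: \<beta>_def \<gamma>_def R_def)
    have "(v i)\<^sup>2 \<le> (\<Sum>i = 1..<n. (v i)\<^sup>2)"
      by (rule member_le_sum) (use i in auto)
    with sum' have v2: "(v i)\<^sup>2 + (v 0)\<^sup>2 \<le> 1" by linarith
    have prof: "profile n (x 0) = R + \<gamma> * v 0"
    proof -
      have "profile n (x 0) = profile n (john_point n 0) + \<alpha> / (8 * height n) * v 0"
        by (simp add: profile_def x0 john_point_def \<alpha>_def diff_divide_distrib add_divide_distrib algebra_simps)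
      then show ?thesis
        unfolding profile_john_point \<alpha>_def john_axis_0_slope by (simp add: R_def \<gamma>_def)
    qed
    \<comment> \<open>Lagrange's identity, that is, Cauchy-Schwarz with its remainder.\<close>
    have "(\<beta> * \<bar>v i\<bar> - \<gamma> * v 0)\<^sup>2 + (\<beta> * v 0 + \<gamma> * \<bar>v i\<bar>)\<^sup>2 = (\<beta>\<^sup>2 + \<gamma>\<^sup>2) * (\<bar>v i\<bar>\<^sup>2 + (v 0)\<^sup>2)"
      by algebra
    moreover have "\<dots> \<le> R\<^sup>2 * 1"
      unfolding pyth using v2 by (intro mult_left_mono) auto
    ultimately have "(\<beta> * \<bar>v i\<bar> - \<gamma> * v 0)\<^sup>2 \<le> R\<^sup>2"
      using zero_le_power2[of "\<beta> * v 0 + \<gamma> * \<bar>v i\<bar>"] by linarith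
    then have "\<beta> * \<bar>v i\<bar> - \<gamma> * v 0 \<le> R"
      by (rule power2_le_imp_le) (simp add: R_def)
    moreover have "\<bar>x i\<bar> = \<beta> * \<bar>v i\<bar>"
      using i0 n john_axis_pos[of n i] by (simp add: xv john_point_def \<beta>_def abs_mult)
    ultimately show ?thesis
      by (simp add: prof)
  qed
  moreover have "- (2 / real n) \<le> x 0"
    using x0_ge by (rule order.trans[rotated]) simp
  ultimately show "x \<in> body n"
    using x x0_le by (auto simp: body_def triangular_ellipsoid_def)
qed

text \<open>Duality of the Euclidean norm: \<open>u = g / s\<close> is the extremal vector. For
  \<open>g = 0\<close> the vector \<open>u = 0\<close> still yields
  \<open>0 \<le> r\<close>.\<close>

lemma norm_le_of_linear_bound:
  fixes g :: "nat \<Rightarrow> real"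
  assumes "\<And>u. (\<Sum>i<n. (u i)\<^sup>2) \<le> 1 \<Longrightarrow> (\<Sum>i<n. g i * u i) \<le> r"
  shows "(\<Sum>i<n. (g i)\<^sup>2) \<le> r\<^sup>2"
proof -
  define s where "s = sqrt (\<Sum>i<n. (g i)\<^sup>2)"
  have s: "0 \<le> s" "s\<^sup>2 = (\<Sum>i<n. (g i)\<^sup>2)"
    by (simp_all add: s_def sum_nonneg)
  have "s \<le> r"
  proof (cases "s = 0")
    case True
    then show ?thesis using assms[of "\<lambda>_. 0"] by simp
  next
    case False
    have "(\<Sum>i<n. (g i / s)\<^sup>2) = (\<Sum>i<n. (g i)\<^sup>2) / s\<^sup>2"
      by (simp add: power_divide sum_divide_distrib)
    then have "(\<Sum>i<n. (g i / s)\<^sup>2) \<le> 1"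
      using False s by simp
    from assms[OF this] have "(\<Sum>i<n. (g i)\<^sup>2) / s \<le> r"
      by (simp add: sum_divide_distrib power2_eq_square)
    then show ?thesis
      using False unfolding s(2)[symmetric] by (simp add: power2_eq_square)
  qed
  then show ?thesis
    using s by (metis power_mono)
qed

text \<open>Test vectors in the plane of the axis and one lateral coordinate.\<close>

definition two_point :: "nat \<Rightarrow> real \<Rightarrow> real \<Rightarrow> point" where
  "two_point i a b j = (if j = 0 then a else if j = i then b else 0)"

lemma sum_two_point:
  assumes "0 < i" "i < n"
  shows "(\<Sum>j<n. f j * two_point i a b j) = f 0 * a + f i * b"
    and "(\<Sum>j<n. (two_point i a b j)\<^sup>2) = a\<^sup>2 + b\<^sup>2"
proof -
  have n0: "0 < n" using assms by simp
  have "(\<Sum>j = 1..<n. f j * two_point i a b j) = (\<Sum>j\<in>{1..<n}. if j = i then f i * b else 0)"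
    by (intro sum.cong) (auto simp: two_point_def)
  then show "(\<Sum>j<n. f j * two_point i a b j) = f 0 * a + f i * b"
    using assms by (simp add: sum_lessThan_split_0[OF n0] two_point_def)
  have "(\<Sum>j = 1..<n. (two_point i a b j)\<^sup>2) = (\<Sum>j\<in>{1..<n}. if j = i then b\<^sup>2 else 0)"
    by (intro sum.cong) (auto simp: two_point_def)
  then show "(\<Sum>j<n. (two_point i a b j)\<^sup>2) = a\<^sup>2 + b\<^sup>2"
    using assms by (simp add: sum_lessThan_split_0[OF n0] two_point_def)
qed

section \<open>Ellipsoids inscribed in the body\<close>

context
  fixes n :: nat and c :: point and S :: "nat \<Rightarrow> nat \<Rightarrow> real"
  assumes n: "100 \<le> n" and S: "lower_triangular n S"
    and inside: "\<And>u. (\<Sum>i<n. (u i)\<^sup>2) \<le> 1 \<Longrightarrow> (\<lambda>i. c i + mat_apply n S u i) \<in> body n"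
begin

lemma inscribed_upper_zero: "i < n \<Longrightarrow> i < j \<Longrightarrow> S i j = 0"
  using S by (simp add: lower_triangular_def)

lemma inscribed_diag_pos: "i < n \<Longrightarrow> 0 < S i i"
  using S by (simp add: lower_triangular_def)

lemma inscribed_top_bound: "c 0 + S 0 0 \<le> 1 / 2"
proof -
  have i: "0 < (1::nat)" "1 < n" using n by auto
  \<comment> \<open>The vector \<open>two_point 1 1 0\<close> is the unit vector of the
    axis.\<close>
  have "(\<lambda>i. c i + mat_apply n S (two_point 1 1 0) i) \<in> body n"
    by (rule inside) (subst sum_two_point(2)[OF i], simp)
  then have "c 0 + mat_apply n S (two_point 1 1 0) 0 \<le> 1 / 2"
    unfolding body_def by blast
  then show ?thesis
    unfolding mat_apply_def sum_two_point(1)[OF i] using n by simp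
qed

lemma inscribed_lateral_bound:
  assumes u: "(\<Sum>j<n. (u j)\<^sup>2) \<le> 1" and i: "0 < i" "i < n"
  shows "\<bar>c i + (\<Sum>j<n. S i j * u j)\<bar> \<le> profile n (c 0 + (\<Sum>j<n. S 0 j * u j))"
  using inside[OF u] i by (simp add: body_def mat_apply_def)

text \<open>
  The two points used are those where the John ellipsoid touches the facets \<open>\<plusminus>x\<^sub>i = profile n x\<^sub>0\<close>.
\<close>

lemma inscribed_tangent_bounds:
  assumes i: "0 < i" "i < n"
  shows "c i - S i 0 / n + S i i * sqrt (1 - 1 / (real n)\<^sup>2) \<le> profile n (c 0 - S 0 0 / n)"
    and "- (c i - S i 0 / n) + S i i * sqrt (1 - 1 / (real n)\<^sup>2) \<le> profile n (c 0 - S 0 0 / n)"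
proof -
  define \<tau> where "\<tau> = sqrt (1 - 1 / (real n)\<^sup>2)"
  have "1 \<le> (real n)\<^sup>2" using n by simp
  then have \<tau>: "\<tau>\<^sup>2 = 1 - 1 / (real n)\<^sup>2"
    by (simp add: \<tau>_def divide_le_eq)
  have le: "\<bar>c i + (S i 0 * (- 1 / n) + S i i * b)\<bar> \<le> profile n (c 0 + (S 0 0 * (- 1 / n) + S 0 i * b))"
    if "b\<^sup>2 = \<tau>\<^sup>2" for b
    using inscribed_lateral_bound[OF _ i, of "two_point i (- 1 / n) b"] that
    by (simp only: sum_two_point[OF i]) (simp add: \<tau> power_divide)
  have "S 0 i = 0" using inscribed_upper_zero i by simp
  with le[of \<tau>] le[of "- \<tau>"]
  show "c i - S i 0 / n + S i i * sqrt (1 - 1 / (real n)\<^sup>2) \<le> profile n (c 0 - S 0 0 / n)"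
    and "- (c i - S i 0 / n) + S i i * sqrt (1 - 1 / (real n)\<^sup>2) \<le> profile n (c 0 - S 0 0 / n)"
    unfolding \<tau>_def[symmetric] by (simp_all add: abs_le_iff)
qed

text \<open>The top bound eliminates \<open>c 0\<close>: the height \<open>c 0 - S 0 0 / n\<close>
  lies at least \<open>(1 + 1 / n) * S 0 0\<close> below the top, and \<open>profile n\<close> is
  increasing.\<close>

lemma inscribed_profile_le:
  "profile n (c 0 - S 0 0 / n) \<le> 1 / 2 - S 0 0 / john_axis n 0 / (2 * real n)"
proof -
  have N: "0 < real n" using n by simp
  have \<alpha>: "john_axis n 0 \<noteq> 0" using john_axis_pos[of n 0] n by simp
  have "S 0 0 + S 0 0 / n \<le> 1 / 2 - (c 0 - S 0 0 / n)"
    using inscribed_top_bound by simp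
  then have "(S 0 0 + S 0 0 / n) / (8 * height n) \<le> (1 / 2 - (c 0 - S 0 0 / n)) / (8 * height n)"
    by (intro divide_right_mono) (simp_all add: less_imp_le)
  moreover have "(S 0 0 + S 0 0 / n) / (8 * height n)
      = S 0 0 / john_axis n 0 * (1 + 1 / n) * (john_axis n 0 / (8 * height n))"
    using \<alpha> N by (auto simp: divide_simps algebra_simps simp del: height_pos)
  moreover have "\<dots> = S 0 0 / john_axis n 0 / (2 * real n)"
  proof -
    have slope: "(1 + 1 / real n) * (1 / (2 * (real n + 1))) = 1 / (2 * real n)"
      using N by (simp add: divide_simps)
    then show ?thesis
      unfolding john_axis_0_slope mult.assoc slope by simp
  qed
  ultimately show ?thesis
    by (simp add: profile_def)
qed

text \<open>The John ellipsoid touches a lateral facet at normalized coordinates \<open>-1/n\<close>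
  and \<open>sqrt (1 - 1/n^2)\<close>, up to sign in the second; the right side is the half-width of
  the cone at that height.\<close>

lemma john_axis_sqrt:
  assumes "0 < i"
  shows "john_axis n i * sqrt (1 - 1 / (real n)\<^sup>2) = (real n - 1) / (2 * real n)"
proof -
  define M where "M = real n - 1"
  have M: "0 < M" "real n = M + 1" using n by (simp_all add: M_def)
  have "(M / (M + 2)) * (1 - 1 / (M + 1)\<^sup>2) = (M / (M + 1))\<^sup>2"
    using M(1) by (simp add: divide_simps) (simp add: algebra_simps power2_eq_square)
  then have prod: "sqrt (M / (M + 2)) * sqrt (1 - 1 / (M + 1)\<^sup>2) = M / (M + 1)"
    using M(1) by (simp add: real_sqrt_mult[symmetric])
  have "john_axis n i = sqrt (M / (M + 2)) / 2"
    using assms by (simp add: john_axis_def M_def add.commute)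
  then have "john_axis n i * sqrt (1 - 1 / (M + 1)\<^sup>2)
      = sqrt (M / (M + 2)) * sqrt (1 - 1 / (M + 1)\<^sup>2) / 2"
    by (simp only: times_divide_eq_left)
  also have "\<dots> = (M + 1 - 1) / (2 * (M + 1))"
    unfolding prod by (simp add: mult.commute)
  finally show ?thesis
    unfolding M(2) .
qed

lemma inscribed_normalized_bound:
  assumes i: "0 < i" "i < n"
  shows "(real n - 1) * (S i i / john_axis n i) + S 0 0 / john_axis n 0 \<le> n"
proof -
  have N: "0 < real n" using n by simp
  have \<beta>: "john_axis n i \<noteq> 0" using john_axis_pos[of n i] n by simp
  define a where "a = S i i / john_axis n i"
  define b where "b = S 0 0 / john_axis n 0"
  have "S i i * sqrt (1 - 1 / (real n)\<^sup>2) = a * ((real n - 1) / (2 * real n))"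
    unfolding john_axis_sqrt[OF i(1), symmetric] using \<beta> by (simp add: a_def)
  \<comment> \<open>The mean of the two tangent bounds no longer contains
    \<open>c i - S i 0 / n\<close>.\<close>
  then have "a * ((real n - 1) / (2 * real n)) \<le> 1 / 2 - b / (2 * real n)"
    using inscribed_tangent_bounds[OF i] inscribed_profile_le by (simp add: b_def)
  then have "2 * real n * (a * ((real n - 1) / (2 * real n))) \<le> 2 * real n * (1 / 2 - b / (2 * real n))"
    using N by (intro mult_left_mono) auto
  moreover have "2 * real n * (a * ((real n - 1) / (2 * real n))) = (real n - 1) * a"
    using N by simp
  moreover have "2 * real n * (1 / 2 - b / (2 * real n)) = n - b"
    using N by (simp add: right_diff_distrib)
  ultimately show ?thesis
    unfolding a_def b_def by linarith
qed

lemma inscribed_trace_bound: "(\<Sum>i<n. S i i / john_axis n i) \<le> n"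
proof -
  have n0: "0 < n" and N: "0 < real n - 1" using n by auto
  define a where "a i = S i i / john_axis n i" for i
  \<comment> \<open>The axial term occurs once for each of the \<open>n - 1\<close> lateral indices,
    so every ratio receives the weight \<open>n - 1\<close>.\<close>
  have "(\<Sum>i = 1..<n. (real n - 1) * a i + a 0) \<le> (\<Sum>i = 1..<n. real n)"
    unfolding a_def by (rule sum_mono) (rule inscribed_normalized_bound, auto)
  then have "(real n - 1) * ((\<Sum>i = 1..<n. a i) + a 0) \<le> (real n - 1) * n"
    using n0 by (simp add: sum.distrib sum_distrib_left[symmetric] of_nat_diff distrib_left)
  then have "(\<Sum>i<n. a i) \<le> n"
    using N by (simp add: sum_lessThan_split_0[OF n0])
  then show ?thesis
    unfolding a_def .
qed

lemma inscribed_normalized_diag_pos: "i < n \<Longrightarrow> 0 < S i i / john_axis n i"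
  using inscribed_diag_pos john_axis_pos[of n i] n by simp

text \<open>When all ratios are 1, the top and tangent bounds are tight and determine the center up
  to the shear entries \<open>S i 0\<close>.\<close>

lemma maximal_center:
  assumes eq: "\<And>i. i < n \<Longrightarrow> S i i = john_axis n i"
  shows "c 0 = john_point n 0" and "0 < i \<Longrightarrow> i < n \<Longrightarrow> c i = S i 0 / n"
proof -
  have N: "0 < real n" using n by simp
  have \<alpha>: "0 < john_axis n 0" using john_axis_pos[of n 0] n by simp
  have le: "profile n (c 0 - S 0 0 / n) \<le> (real n - 1) / (2 * real n)"
  proof -
    have "profile n (c 0 - S 0 0 / n) \<le> 1 / 2 - 1 / (2 * real n)"
      using inscribed_profile_le \<alpha> eq[of 0] n by simp
    also have "\<dots> = (real n - 1) / (2 * real n)"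
      using N by (simp add: diff_divide_distrib)
    finally show ?thesis .
  qed
  have S: "S i i * sqrt (1 - 1 / (real n)\<^sup>2) = (real n - 1) / (2 * real n)" if "0 < i" "i < n" for i
    using that by (simp only: eq john_axis_sqrt)
  \<comment> \<open>The two tangent bounds squeeze \<open>c i - S i 0 / n\<close> between 0 and
    0.\<close>
  show "0 < i \<Longrightarrow> i < n \<Longrightarrow> c i = S i 0 / n"
    using inscribed_tangent_bounds[of i] S[of i] le by linarith
  have "(real n - 1) / (2 * real n) \<le> profile n (c 0 - S 0 0 / n)"
    using inscribed_tangent_bounds[of 1] S[of 1] n by linarith
  moreover have "(real n - 1) / (2 * real n) = profile n (john_point n 0 - john_axis n 0 / n)"
  proof -
    have "profile n (john_point n 0 - john_axis n 0 / n)
        = profile n (john_point n 0) - john_axis n 0 / (8 * height n) / n"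
      by (simp add: profile_def diff_divide_distrib)
    also have "\<dots> = (real n - 1) / (2 * real n)"
      unfolding profile_john_point john_axis_0_slope using N
      by (simp add: divide_simps) (simp add: algebra_simps)
    finally show ?thesis ..
  qed
  ultimately have "profile n (john_point n 0 - john_axis n 0 / n) \<le> profile n (c 0 - john_axis n 0 / n)"
    using eq[of 0] n by simp
  then have "john_point n 0 \<le> c 0"
    using height_pos[of n] by (simp add: profile_def divide_le_cancel del: height_pos)
  moreover have "c 0 \<le> john_point n 0"
    using inscribed_top_bound eq[of 0] n by (simp add: john_point_def)
  ultimately show "c 0 = john_point n 0" by simp
qed

text \<open>Two opposite facets bound the whole of row \<open>i\<close>. By the tangency relation
  the off-diagonal part is at most the square of \<open>c i = S i 0 / n\<close>, although it
  contains the square of \<open>S i 0\<close>.\<close>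

lemma maximal_off_diag:
  assumes eq: "\<And>i. i < n \<Longrightarrow> S i i = john_axis n i" and i: "0 < i" "i < n"
  shows "(\<Sum>j\<in>{..<n} - {i}. (S i j)\<^sup>2) = 0"
proof -
  have n0: "0 < n" using n by simp
  define \<kappa> where "\<kappa> = 1 / (8 * height n)"
  define R where "R = real n / (2 * (real n + 1))"
  have prof: "profile n (c 0 + t) = R + \<kappa> * t" for t
    using profile_john_point[of n] maximal_center(1)[OF eq]
    by (simp add: profile_def R_def \<kappa>_def diff_divide_distrib add_divide_distrib algebra_simps)
  \<comment> \<open>\<open>e\<close> selects one of the two opposite facets; its constraint is a
    linear bound on the whole unit ball, hence a norm bound.\<close>
  have "(\<Sum>j<n. (e * S i j - \<kappa> * S 0 j)\<^sup>2) \<le> (R - e * c i)\<^sup>2" if e: "e = 1 \<or> e = - 1" for e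
  proof (rule norm_le_of_linear_bound)
    fix u :: point assume u: "(\<Sum>j<n. (u j)\<^sup>2) \<le> 1"
    have "e * (c i + (\<Sum>j<n. S i j * u j)) \<le> \<bar>c i + (\<Sum>j<n. S i j * u j)\<bar>"
      using e by auto
    also have "\<dots> \<le> R + \<kappa> * (\<Sum>j<n. S 0 j * u j)"
      using inscribed_lateral_bound[OF u i] by (simp add: prof)
    finally show "(\<Sum>j<n. (e * S i j - \<kappa> * S 0 j) * u j) \<le> R - e * c i"
      by (simp add: left_diff_distrib sum_subtractf sum_distrib_left mult.assoc distrib_left)
  qed
  from this[of 1] this[of "- 1"]
  have "(\<Sum>j<n. (S i j - \<kappa> * S 0 j)\<^sup>2) + (\<Sum>j<n. (- S i j - \<kappa> * S 0 j)\<^sup>2) \<le> (R - c i)\<^sup>2 + (R + c i)\<^sup>2"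
    by simp
  also have "(\<Sum>j<n. (S i j - \<kappa> * S 0 j)\<^sup>2) + (\<Sum>j<n. (- S i j - \<kappa> * S 0 j)\<^sup>2)
      = 2 * ((\<Sum>j<n. (S i j)\<^sup>2) + \<kappa>\<^sup>2 * (\<Sum>j<n. (S 0 j)\<^sup>2))"
  proof -
    have "(a - b)\<^sup>2 + (- a - b)\<^sup>2 = 2 * (a\<^sup>2 + b\<^sup>2)" for a b :: real
      by (simp add: power2_eq_square algebra_simps)
    then show ?thesis
      by (simp add: sum.distrib[symmetric] sum_distrib_left power_mult_distrib del: sum.distrib)
  qed
  finally have "(\<Sum>j<n. (S i j)\<^sup>2) + \<kappa>\<^sup>2 * (\<Sum>j<n. (S 0 j)\<^sup>2) \<le> R\<^sup>2 + (c i)\<^sup>2"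
    by (simp add: power2_eq_square algebra_simps)
  moreover have "\<kappa>\<^sup>2 * (\<Sum>j<n. (S 0 j)\<^sup>2) = (1 / (2 * (real n + 1)))\<^sup>2"
  proof -
    have "(\<Sum>j<n. (S 0 j)\<^sup>2) = (john_axis n 0)\<^sup>2"
      using eq[of 0] n0 by (simp add: sum_lessThan_split_0[OF n0] inscribed_upper_zero)
    then show ?thesis
      unfolding john_axis_0_slope[symmetric] by (simp add: \<kappa>_def power_divide)
  qed
  moreover have "(\<Sum>j<n. (S i j)\<^sup>2) = (john_axis n i)\<^sup>2 + (\<Sum>j\<in>{..<n} - {i}. (S i j)\<^sup>2)"
    using i by (simp add: sum.remove eq)
  moreover have "(john_axis n i)\<^sup>2 + (1 / (2 * (real n + 1)))\<^sup>2 = R\<^sup>2"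
    unfolding R_def by (rule john_axes_pythagoras) (use n i in auto)
  moreover have "(c i)\<^sup>2 = (S i 0)\<^sup>2 / (real n)\<^sup>2"
    using maximal_center(2)[OF eq i] by (simp add: power_divide)
  ultimately have le: "(\<Sum>j\<in>{..<n} - {i}. (S i j)\<^sup>2) \<le> (S i 0)\<^sup>2 / (real n)\<^sup>2"
    by linarith
  have "(S i 0)\<^sup>2 \<le> (\<Sum>j\<in>{..<n} - {i}. (S i j)\<^sup>2)"
    by (rule member_le_sum) (use i in auto)
  \<comment> \<open>Any factor below 1 suffices: then \<open>S i 0\<close> must vanish, and the
    off-diagonal part with it.\<close>
  moreover have "(S i 0)\<^sup>2 / (real n)\<^sup>2 \<le> (S i 0)\<^sup>2 / 2"
  proof (rule divide_left_mono)
    have "2 \<le> real n * real n" using n by (intro order.trans[OF _ mult_mono[of 2 "real n" 1 "real n"]]) auto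
    then show "2 \<le> (real n)\<^sup>2" by (simp add: power2_eq_square)
  qed (use n in auto)
  ultimately have "(S i 0)\<^sup>2 / (real n)\<^sup>2 \<le> 0"
    using le zero_le_power2[of "S i 0"] by linarith
  with le show ?thesis
    by (intro antisym sum_nonneg) auto
qed

lemma maximal_determined:
  assumes eq: "\<And>i. i < n \<Longrightarrow> S i i = john_axis n i"
  shows "i < n \<Longrightarrow> j < n \<Longrightarrow> S i j = (if i = j then john_axis n i else 0)"
    and "i < n \<Longrightarrow> c i = john_point n i"
proof -
  have off: "S i j = 0" if "0 < i" "i < n" "j < n" "i \<noteq> j" for i j
    using maximal_off_diag[OF eq that(1,2)] that by (auto simp: sum_nonneg_eq_0_iff)
  show "i < n \<Longrightarrow> j < n \<Longrightarrow> S i j = (if i = j then john_axis n i else 0)"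
    using off[of i j] eq[of i] inscribed_upper_zero[of i j] by (cases "i = 0") auto
  show "i < n \<Longrightarrow> c i = john_point n i"
    using maximal_center[OF eq] off[of i 0] by (cases "i = 0") (auto simp: john_point_def)
qed

end

text \<open>The ratios \<open>S i i / john_axis n i\<close> have sum at most \<open>n\<close>, so
  their product, the volume ratio to the candidate, is at most 1; in the equality case
  \<open>S\<close> and \<open>c\<close> are determined.\<close>

lemma john_center_body:
  assumes n: "100 \<le> n"
  shows "john_center n (body n) = john_point n"
proof (rule john_center_eqI)
  let ?V = "topspace (Euclidean_space n)"
  let ?D = "diag_mat (\<lambda>i. inverse (john_axis n i))"
  let ?E = "triangular_ellipsoid n ?D (john_point n)"
  have pos: "0 < john_axis n i" for i using john_axis_pos[of n i] n by simp
  have p: "john_point n \<in> ?V" using n by (simp add: topspace_Euclidean_space john_point_def)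
  define A where "A = (\<Prod>i<n. john_axis n i)"
  have A: "0 < A" unfolding A_def using pos by (intro prod_pos) auto
  have vol0: "vol n ?E = unit_ball_vol n * A"
    using vol_triangular_ellipsoid[OF lower_triangular_diag_mat p, of "\<lambda>i. inverse (john_axis n i)"] pos
    by (simp add: diag_mat_def A_def prod_inversef[symmetric] divide_inverse)
  show "ellipsoid_at n (john_point n) ?E"
    by (rule ellipsoid_at_diag) (use pos p in auto)
  show "?E \<subseteq> body n"
    by (rule john_ellipsoid_subset_body[OF n])
  fix c E assume E: "ellipsoid_at n c E" "E \<subseteq> body n"
  then have c: "c \<in> ?V" by (simp add: ellipsoid_at_def)
  obtain T where T: "lower_triangular n T" and ET: "E = triangular_ellipsoid n T c"
    using ellipsoid_at_imp_triangular[OF E(1)] by blast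
  obtain S where S: "lower_triangular n S" "\<And>i. i < n \<Longrightarrow> S i i = inverse (T i i)"
    and TS: "\<And>x i. i < n \<Longrightarrow> (\<Sum>j<n. T i j * mat_apply n S x j) = x i"
    using lower_triangular_right_inverse[OF T] by blast
  have inside: "(\<lambda>i. c i + mat_apply n S u i) \<in> body n" if "(\<Sum>i<n. (u i)\<^sup>2) \<le> 1" for u
  proof -
    have "mat_apply n T (\<lambda>i. mat_apply n S u i) = (\<lambda>i. if i < n then u i else 0)"
      using TS unfolding mat_apply_def[of n T] by auto
    then have "(\<lambda>i. c i + mat_apply n S u i) \<in> E"
      using that c mat_apply_in_space[of n S u]
      by (simp add: ET triangular_ellipsoid_def enorm_le_1_iff topspace_Euclidean_space)
    then show ?thesis using E(2) by blast
  qed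
  note john = inscribed_trace_bound[OF n S(1) inside] inscribed_normalized_diag_pos[OF n S(1) inside]
    maximal_determined[OF n S(1) inside]
  define P where "P = (\<Prod>i<n. T i i)"
  have P: "0 < P" unfolding P_def using T by (intro prod_pos) (auto simp: lower_triangular_def)
  have volE: "vol n E = unit_ball_vol n / P"
    unfolding ET P_def by (rule vol_triangular_ellipsoid[OF T c])
  have ratio: "(\<Prod>i<n. S i i / john_axis n i) = inverse P / A"
    by (simp add: prod_dividef A_def P_def S(2) prod_inversef[symmetric])
  have "inverse P / A \<le> 1"
    unfolding ratio[symmetric] by (rule prod_le_1_of_sum_le(1)[OF john(2,1)])
  then have "inverse P \<le> A" using A by (simp add: divide_le_eq)
  then show "vol n E \<le> vol n ?E"
    unfolding vol0 volE divide_inverse by (intro mult_left_mono) auto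
  assume "vol n E = vol n ?E"
  then have "unit_ball_vol n * inverse P = unit_ball_vol n * A"
    by (simp add: vol0 volE divide_inverse)
  moreover have "unit_ball_vol n \<noteq> 0" using unit_ball_vol_pos[of n] by linarith
  ultimately have "inverse P = A" by simp
  then have one: "(\<Prod>i<n. S i i / john_axis n i) = 1"
    unfolding ratio using A by simp
  have eq: "S i i = john_axis n i" if "i < n" for i
  proof -
    have "S i i / john_axis n i = 1"
      by (rule prod_le_1_of_sum_le(2)[OF john(2,1) one that])
    then show ?thesis using pos[of i] by simp
  qed
  have Sij: "S i j = (if i = j then john_axis n i else 0)" if "i < n" "j < n" for i j
    by (rule john(3)[OF _ eq that])
  have ci: "c i = john_point n i" if "i < n" for i
    by (rule john(4)[OF _ eq that])
  have "c = john_point n"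
  proof
    fix i show "c i = john_point n i"
      using ci[of i] c p by (cases "i < n") (auto simp: topspace_Euclidean_space)
  qed
  \<comment> \<open>\<open>S\<close> is now diagonal; evaluating \<open>T S\<close> at the unit
    vectors recovers \<open>T\<close> column by column.\<close>
  moreover have "T i k = ?D i k" if "i < n" "k < n" for i k
  proof -
    have "mat_apply n S (\<lambda>j. if j = k then 1 else 0) j = (if j = k then john_axis n k else 0)" if "j < n" for j
      using that \<open>k < n\<close> by (simp add: mat_apply_def Sij if_distrib[where f="\<lambda>y. _ * y"] cong: if_cong)
    then have "(\<Sum>j<n. T i j * mat_apply n S (\<lambda>j. if j = k then 1 else 0) j)
        = (\<Sum>j<n. if j = k then T i k * john_axis n k else 0)"
      by (intro sum.cong) auto
    then have "T i k * john_axis n k = (if i = k then 1 else 0)"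
      using TS[OF \<open>i < n\<close>, of "\<lambda>j. if j = k then 1 else 0"] \<open>k < n\<close> by simp
    then show ?thesis
      using pos[of k] by (auto simp: diag_mat_def field_simps split: if_splits)
  qed
  then have "mat_apply n T x = mat_apply n ?D x" for x
    by (auto simp: mat_apply_def fun_eq_iff intro!: sum.cong)
  ultimately show "E = ?E \<and> c = john_point n"
    by (simp add: ET triangular_ellipsoid_def)
qed

section \<open>The relative distance along the axis\<close>

lemma height_nonzero [simp]: "height n \<noteq> 0"
  using height_pos[of n] by linarith

lemma profile_ge:
  assumes "- (2 / n) \<le> t"
  shows "3 / 8 \<le> profile n t"
proof -
  have "(1 / 2 - t) / (8 * height n) \<le> height n / (8 * height n)"
    using assms by (intro divide_right_mono) (simp_all add: height_def)
  also have "\<dots> = 1 / 8" using height_pos[of n] by simp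
  finally show ?thesis unfolding profile_def by linarith
qed

text \<open>The ball condition stays explicit because for \<open>n = 1\<close> the height
  \<open>-2/n\<close> lies outside the unit ball.\<close>

lemma axis_point_in_body_iff:
  assumes "1 \<le> n"
  shows "(\<lambda>i. if i = 0 then a else 0) \<in> body n \<longleftrightarrow> - (2 / n) \<le> a \<and> a \<le> 1 / 2 \<and> a\<^sup>2 \<le> 1"
proof -
  have "0 \<le> profile n a" if "- (2 / n) \<le> a"
    using profile_ge[OF that] by linarith
  then show ?thesis
    using assms by (auto simp: body_def topspace_Euclidean_space sum_lessThan_split_0)
qed

text \<open>Both centers lie on the axis, whose chord has length \<open>height n\<close>; the value
  is the height of the John center divided by this length.\<close>

lemma rel_dist_body:
  assumes n: "100 \<le> n"
  shows "rel_dist n (body n) (john_point n) (\<lambda>_. 0) = n / (real n + 4) - 4 / (real n + 1)"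
proof -
  define a where "a = john_point n 0"
  have a: "0 < a"
    using john_axis_0_le[OF n] by (simp add: a_def john_point_def)
  have p: "john_point n = (\<lambda>i. if i = 0 then a else 0)"
    by (auto simp: a_def john_point_def)
  have norm: "enorm n (\<lambda>i. if i = 0 then b else 0) = \<bar>b\<bar>" for b
    using n by (simp add: enorm_def L2_set_def sum_lessThan_split_0)
  have norm1: "enorm n (\<lambda>i. john_point n i - 0) = a"
    using norm[of a] a by (simp add: p)
  have norm2: "enorm n (\<lambda>i. 0 - john_point n i) = a"
  proof -
    have "(\<lambda>i. 0 - john_point n i) = (\<lambda>i. if i = 0 then - a else 0)" by (auto simp: p)
    then show ?thesis using norm[of "- a"] a by simp
  qed
  \<comment> \<open>The unit-speed parametrization starts at the John center and runs down through
    the origin, so parameter \<open>t\<close> has height \<open>a - t\<close>.\<close>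
  have "{t. (\<lambda>i. john_point n i + t * ((0 - john_point n i) / a)) \<in> line_through (john_point n) (\<lambda>_. 0) \<inter> body n}
      = {a - 1 / 2 .. a + 2 / n}"
  proof -
    have eq: "(\<lambda>i. john_point n i + t * ((0 - john_point n i) / a)) = (\<lambda>i. if i = 0 then a - t else 0)" for t
      using a by (auto simp: p)
    have line: "(\<lambda>i. if i = 0 then a - t else 0) \<in> line_through (john_point n) (\<lambda>_. 0)" for t
      unfolding line_through_def by (rule image_eqI[of _ _ "t / a"]) (use a in \<open>auto simp: p\<close>)
    have "a - t \<le> 1 / 2 \<Longrightarrow> - (2 / n) \<le> a - t \<Longrightarrow> (a - t)\<^sup>2 \<le> 1" for t
    proof -
      assume "a - t \<le> 1 / 2" "- (2 / n) \<le> a - t"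
      moreover have "2 / real n \<le> 1" using n by simp
      ultimately have "\<bar>a - t\<bar> \<le> 1" by linarith
      then show ?thesis by (simp add: abs_square_le_1)
    qed
    then show ?thesis
      unfolding eq using line n by (auto simp: axis_point_in_body_iff)
  qed
  moreover have "a - 1 / 2 \<le> a + 2 / n"
    using divide_nonneg_nonneg[of 2 "real n"] by linarith
  ultimately have vol1: "vol1_on_line n (john_point n) (\<lambda>_. 0) (line_through (john_point n) (\<lambda>_. 0) \<inter> body n) = height n"
    unfolding vol1_on_line_def norm2 using n by (simp add: height_def add.commute)
  have "john_point n \<noteq> (\<lambda>_. 0)" using a by (metis a_def less_irrefl)
  then have "rel_dist n (body n) (john_point n) (\<lambda>_. 0) = a / height n"
    unfolding rel_dist_def vol1 norm1 by simp
  also have "\<dots> = 1 / (2 * height n) - 4 / (real n + 1)"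
    using height_pos[of n] by (simp add: a_def john_point_def john_axis_def diff_divide_distrib add.commute)
  also have "1 / (2 * height n) = n / (real n + 4)"
    using n by (simp add: height_def divide_simps)
  finally show ?thesis .
qed

section \<open>Compactness, convexity and interior of the body\<close>

lemma closed_body: "closed (body n)"
proof -
  have [continuous_intros]: "continuous_on UNIV (\<lambda>x::point. x i)" for i
    by (rule continuous_on_product_coordinates)
  have "closed (\<Inter>i\<in>{n..}. {x :: point. x i = 0})"
    by (intro closed_INT ballI closed_Collect_eq continuous_intros)
  moreover have "closed {x :: point. (\<Sum>i<n. (x i)\<^sup>2) \<le> 1}" "closed {x :: point. - (2 / n) \<le> x 0}" "closed {x :: point. x 0 \<le> 1 / 2}"
    by (intro closed_Collect_le continuous_intros)+
  moreover have "closed (\<Inter>i\<in>{1..<n}. {x :: point. \<bar>x i\<bar> \<le> profile n (x 0)})"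
    unfolding profile_def divide_inverse
    by (intro closed_INT ballI closed_Collect_le continuous_intros)
  moreover have "body n = (\<Inter>i\<in>{n..}. {x. x i = 0}) \<inter> {x. (\<Sum>i<n. (x i)\<^sup>2) \<le> 1} \<inter> {x. - (2 / n) \<le> x 0}
      \<inter> {x. x 0 \<le> 1 / 2} \<inter> (\<Inter>i\<in>{1..<n}. {x. \<bar>x i\<bar> \<le> profile n (x 0)})"
    by (auto simp: body_def topspace_Euclidean_space)
  ultimately show ?thesis by (simp only: closed_Int)
qed

text \<open>A closed subset of the cube \<open>[-1, 1]\<close> to the power of the naturals, which
  is compact by Tychonoff.\<close>

lemma compactin_body: "compactin (Euclidean_space n) (body n)"
proof -
  have "compactin (powertop_real UNIV) (PiE UNIV (\<lambda>_ :: nat. {- 1 .. 1 :: real}))"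
    by (simp add: compactin_PiE)
  then have "compact (PiE UNIV (\<lambda>_ :: nat. {- 1 .. 1 :: real}))"
    by (simp add: euclidean_product_topology)
  moreover have "body n \<subseteq> PiE UNIV (\<lambda>_. {- 1 .. 1})"
  proof
    fix x assume x: "x \<in> body n"
    have "\<bar>x i\<bar> \<le> 1" for i
    proof (cases "i < n")
      case True
      then have "(x i)\<^sup>2 \<le> (\<Sum>i<n. (x i)\<^sup>2)" by (intro member_le_sum) auto
      also have "\<dots> \<le> 1" using x by (simp add: body_def)
      finally show ?thesis by (simp add: abs_square_le_1)
    qed (use x in \<open>simp add: body_def topspace_Euclidean_space\<close>)
    then show "x \<in> PiE UNIV (\<lambda>_. {- 1 .. 1})"
      by (auto simp: abs_le_iff minus_le_iff)
  qed
  ultimately have "compact (body n)"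
    using closed_body[of n] compact_Int_closed by (metis inf.absorb2)
  then show ?thesis
    by (auto simp: Euclidean_space_def compactin_subtopology euclidean_product_topology body_def)
qed

text \<open>The square and the absolute value are convex, and \<open>profile n\<close> is
  affine.\<close>

lemma convex_pts_body: "convex_pts (body n)"
  unfolding convex_pts_def
proof (intro ballI)
  fix x y t assume x: "x \<in> body n" and y: "y \<in> body n" and "t \<in> {0..1 :: real}"
  then have t: "0 \<le> t" "0 \<le> 1 - t" by auto
  let ?z = "\<lambda>i. (1 - t) * x i + t * y i"
  have "(?z i)\<^sup>2 \<le> (1 - t) * (x i)\<^sup>2 + t * (y i)\<^sup>2" for i
  proof -
    have "(1 - t) * (x i)\<^sup>2 + t * (y i)\<^sup>2 - (?z i)\<^sup>2 = t * (1 - t) * (x i - y i)\<^sup>2"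
      by (simp add: power2_eq_square algebra_simps)
    moreover have "0 \<le> \<dots>" using t by simp
    ultimately show ?thesis by linarith
  qed
  then have "(\<Sum>i<n. (?z i)\<^sup>2) \<le> (\<Sum>i<n. (1 - t) * (x i)\<^sup>2 + t * (y i)\<^sup>2)"
    by (intro sum_mono)
  also have "\<dots> = (1 - t) * (\<Sum>i<n. (x i)\<^sup>2) + t * (\<Sum>i<n. (y i)\<^sup>2)"
    by (simp add: sum.distrib sum_distrib_left)
  also have "\<dots> \<le> (1 - t) * 1 + t * 1"
    using x y t by (intro add_mono mult_left_mono) (auto simp: body_def)
  finally have sum: "(\<Sum>i<n. (?z i)\<^sup>2) \<le> 1" by simp
  have mean: "(1 - t) * k + t * k = k" for k by (simp add: left_diff_distrib)
  have "(1 - t) * - (2 / n) + t * - (2 / n) \<le> ?z 0"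
    using x y t by (intro add_mono mult_left_mono) (auto simp: body_def)
  then have bottom: "- (2 / n) \<le> ?z 0" by (simp only: mean)
  have "?z 0 \<le> (1 - t) * (1 / 2) + t * (1 / 2)"
    using x y t by (intro add_mono mult_left_mono) (auto simp: body_def)
  then have top: "?z 0 \<le> 1 / 2" by (simp only: mean)
  have "\<bar>?z i\<bar> \<le> profile n (?z 0)" if i: "i \<in> {1..<n}" for i
  proof -
    have "\<bar>?z i\<bar> \<le> (1 - t) * \<bar>x i\<bar> + t * \<bar>y i\<bar>"
      using abs_triangle_ineq[of "(1 - t) * x i" "t * y i"] t by (simp add: abs_mult)
    also have "\<dots> \<le> (1 - t) * profile n (x 0) + t * profile n (y 0)"
      using x y t i by (intro add_mono mult_left_mono) (auto simp: body_def)
    also have "\<dots> = profile n (?z 0)"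
      by (simp add: profile_def diff_divide_distrib add_divide_distrib algebra_simps)
    finally show ?thesis .
  qed
  moreover have "?z \<in> topspace (Euclidean_space n)"
    using x y by (simp add: body_def topspace_Euclidean_space)
  ultimately show "?z \<in> body n"
    using sum bottom top by (simp add: body_def)
qed

lemma interior_body_nonempty:
  assumes "1 \<le> n"
  shows "Euclidean_space n interior_of body n \<noteq> {}"
proof -
  have N: "1 \<le> real n" using assms by simp
  \<comment> \<open>Small enough for a cube around the origin: \<open>n * \<epsilon> \<le> 1\<close>
    serves the ball, \<open>\<epsilon> \<le> 2 / n\<close> the bottom, and
    \<open>\<epsilon> \<le> 1 / 8\<close> the top and the lateral facets.\<close>
  define \<epsilon> where "\<epsilon> = 1 / (8 * real n)"
  have \<epsilon>: "0 < \<epsilon>" "\<epsilon> \<le> 1 / 8" "\<epsilon> \<le> 2 / n" "n * \<epsilon> \<le> 1"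
    using N by (simp_all add: \<epsilon>_def field_simps)
  define U where "U = {x \<in> topspace (Euclidean_space n). \<forall>i<n. \<bar>x i\<bar> < \<epsilon>}"
  have [continuous_intros]: "continuous_on UNIV (\<lambda>x::point. x i)" for i
    by (rule continuous_on_product_coordinates)
  have "open {x :: point. \<bar>x i\<bar> < \<epsilon>}" for i
    by (intro open_Collect_less continuous_intros)
  then have "open (\<Inter>i<n. {x :: point. \<bar>x i\<bar> < \<epsilon>})"
    by (intro open_INT) auto
  then have "openin (Euclidean_space n) U"
    unfolding Euclidean_space_def openin_subtopology euclidean_product_topology
    by (intro exI[of _ "\<Inter>i<n. {x. \<bar>x i\<bar> < \<epsilon>}"]) (auto simp: U_def topspace_Euclidean_space)
  moreover have "U \<subseteq> body n"
  proof
    fix x assume "x \<in> U"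
    then have V: "x \<in> topspace (Euclidean_space n)" and x: "\<And>i. i < n \<Longrightarrow> \<bar>x i\<bar> \<le> \<epsilon>"
      by (auto simp: U_def less_imp_le)
    have "(\<Sum>i<n. (x i)\<^sup>2) \<le> (\<Sum>i<n. \<epsilon>)"
    proof (rule sum_mono)
      fix i assume "i \<in> {..<n}"
      then have "\<bar>x i\<bar> * \<bar>x i\<bar> \<le> \<epsilon> * 1" using x[of i] \<epsilon> by (intro mult_mono) auto
      then show "(x i)\<^sup>2 \<le> \<epsilon>" by (simp add: power2_eq_square)
    qed
    then have sum: "(\<Sum>i<n. (x i)\<^sup>2) \<le> 1" using \<epsilon> by simp
    have x0: "- (2 / n) \<le> x 0" "x 0 \<le> 1 / 2"
      using x[of 0] assms \<epsilon> by linarith+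
    have "3 / 8 \<le> profile n (x 0)" using x0(1) by (rule profile_ge)
    then have "\<bar>x i\<bar> \<le> profile n (x 0)" if "i < n" for i
      using x[OF that] \<epsilon> by linarith
    then show "x \<in> body n" using V sum x0 by (simp add: body_def)
  qed
  ultimately have "U \<subseteq> Euclidean_space n interior_of body n"
    by (simp add: interior_of_maximal)
  moreover have "(\<lambda>_. 0) \<in> U" using \<epsilon> by (simp add: U_def topspace_Euclidean_space)
  ultimately show ?thesis by blast
qed

theorem theorem6p1:
  shows "\<exists>M :: nat \<Rightarrow> (nat \<Rightarrow> real) set.
    (\<forall>n\<ge>1. M n \<in> convex_bodies n) \<and>
    (\<lambda>n. rel_dist n (M n) (john_center n (M n)) (loewner_center n (M n)) - (1 - 8 / real n))
      \<in> o(\<lambda>n. 1 / real n)"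
proof (intro exI[of _ body] conjI allI impI)
  show "body n \<in> convex_bodies n" if "1 \<le> n" for n
    using that by (simp add: convex_bodies_def compactin_body convex_pts_body interior_body_nonempty)
  \<comment> \<open>Each center contributes \<open>4/n\<close> to first order:
    \<open>n / (n + 4)\<close> is \<open>1 - 4/n\<close> up to second order, and
    \<open>4 / (n + 1)\<close> is \<open>4/n\<close> up to second order.\<close>
  have "(\<lambda>n. n / (real n + 4) - 4 / (real n + 1) - (1 - 8 / real n)) \<in> o(\<lambda>n. 1 / real n)"
    by real_asymp
  moreover have "\<forall>\<^sub>F n in sequentially.
      rel_dist n (body n) (john_center n (body n)) (loewner_center n (body n)) - (1 - 8 / real n)
      = n / (real n + 4) - 4 / (real n + 1) - (1 - 8 / real n)"
    using eventually_ge_at_top[of 100]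
    by eventually_elim (simp add: john_center_body loewner_center_body rel_dist_body)
  ultimately show "(\<lambda>n. rel_dist n (body n) (john_center n (body n)) (loewner_center n (body n))
      - (1 - 8 / real n)) \<in> o(\<lambda>n. 1 / real n)"
    by (subst landau_o.small.in_cong)
qed

end
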